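(* Let $(V,c,b)$ be a braided Lie algebra over a field $K$ such that $c$ is of Hecke type with regular mark $q$. Then $$U(V,c,b)=\frac{T(V,c)}{\big(c(z)-qz-[z]_b\ \mid\ z\in V\otimes V\big)},$$ where $[z]_b=b(c(z)-qz)$ for every $z\in V\otimes V$ (the denominator being the two-sided ideal generated by the listed elements). Moreover, if $q\ne1$ and $\mathrm{char}(K)\ne2$, then $[-]_b=0$.
   Context: $K$ is a field, vector spaces are over $K$, $\otimes=\otimes_K$, and the name of an object also denotes its identity map. A braided vector space $(V,c)$ is a vector space $V$ with a $K$-linear map $c:V\otimes V\to V\otimes V$ such that $(c\otimes V)(V\otimes c)(c\otimes V)=(V\otimes c)(c\otimes V)(V\otimes c)$. The braiding $c$ is of Hecke type with mark $q\in K\setminus\{0\}$ if $(c+\mathrm{Id}_{V\otimes V})(c-q\,\mathrm{Id}_{V\otimes V})=0$. An element $q\in K$ is regular if $(n)_q:=1+q+\cdots+q^{n-1}\ne0$ for all $n\ge2$. A braided bialgebra $(B,m,u,\Delta,\varepsilon,c)$ is an algebra and coalgebra with a braiding $c$ on $B$ commuting with $m,u,\Delta,\varepsilon$ (i.e. $c(m\otimes B)=(B\otimes m)(c\otimes B)(B\otimes c)$, $c(B\otimes m)=(m\otimes B)(B\otimes c)(c\otimes B)$, $c(u\otimes B)=B\otimes u$, $c(B\otimes u)=u\otimes B$, and dually for $\Delta,\varepsilon$) such that $\Delta m=(m\otimes m)(B\otimes c\otimes B)(\Delta\otimes\Delta)$, with $\Delta,\varepsilon$ unital and $\varepsilon$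 multiplicative. $T=T(V,c)$ is the tensor algebra with its unique braided bialgebra structure such that the braiding $c_T$ extends $c$ and elements of $V$ are primitive; it is graded by $T^n=V^{\otimes n}$, with components $\Delta_T^{a,b}:V^{\otimes(a+b)}\to V^{\otimes a}\otimes V^{\otimes b}$. Put $E_n(V,c)=\bigcap_{a,b\ge1,\ a+b=n}\ker(\Delta_T^{a,b})$ for $n\ge2$ and $E(V,c)=\bigoplus_{n\ge2}E_n(V,c)$. In particular $E_2(V,c)=\ker(c+\mathrm{Id}_{V\otimes V})$, so $c(z)-qz\in E_2(V,c)$ for $c$ of Hecke type with mark $q$. The braiding $c_T$ restricts to maps $c_{E(V,c),V}:E(V,c)\otimes V\to V\otimes E(V,c)$ and $c_{V,E(V,c)}:V\otimes E(V,c)\to E(V,c)\otimes V$. A bracket on $(V,c)$ is a $K$-linear map $b:E(V,c)\to V$ with $c(b\otimes V)=(V\otimes b)c_{E(V,c),V}$ and $c(V\otimes b)=(b\otimes V)c_{V,E(V,c)}$. The universal enveloping algebra is $U(V,c,b)=T(V,c)/\big((\mathrm{Id}-b)[E(V,c)]\big)$ (quotient by the generated two-sided ideal), and $i_U:V\to U(V,c,b)$ is the restriction of the canonical projection. $(V,c,b)$ is a braided Lie algebra if $b$ is a bracket on $(V,c)$ and $i_U$ is injective. *)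

theory Defs
  imports Complex_Main "HOL-Library.Poly_Mapping"
begin

section \<open>Tensor products\<close>

text \<open>
  The scalar field is the type \<open>'k\<close>; a vector space is a type together with a scaling satisfying
  \<^locale>\<open>vector_space\<close>.  Tensor products are characterised by their standard construction:
  \<open>(X, \<tau>)\<close> is a tensor product of \<open>A\<close> and \<open>B\<close> if the linear map from the free vector space on
  \<open>A \<times> B\<close> to \<open>X\<close> induced by \<open>\<tau>\<close> is onto and its kernel is spanned by the bilinearity relations.
  All notions below are relative to arbitrary tensor products in this sense.
\<close>

definition free_scale :: "'k::field \<Rightarrow> ('x \<Rightarrow>\<^sub>0 'k) \<Rightarrow> ('x \<Rightarrow>\<^sub>0 'k)"
  where "free_scale r p = Poly_Mapping.map ((*) r) p"

definition free_extend ::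
    "('k::field \<Rightarrow> 'a::ab_group_add \<Rightarrow> 'a) \<Rightarrow> ('x \<Rightarrow> 'a) \<Rightarrow> ('x \<Rightarrow>\<^sub>0 'k) \<Rightarrow> 'a"
  where "free_extend s f p = (\<Sum>x\<in>Poly_Mapping.keys p. s (Poly_Mapping.lookup p x) (f x))"

abbreviation pt :: "'x \<Rightarrow> ('x \<Rightarrow>\<^sub>0 'k::field)"
  where "pt x \<equiv> Poly_Mapping.single x 1"

definition bilinear_relations ::
    "('k::field \<Rightarrow> 'a::ab_group_add \<Rightarrow> 'a) \<Rightarrow> ('k \<Rightarrow> 'b::ab_group_add \<Rightarrow> 'b) \<Rightarrow> ('a \<times> 'b \<Rightarrow>\<^sub>0 'k) set"
  where "bilinear_relations sA sB =
      {pt (x + x', y) - pt (x, y) - pt (x', y) | x x' y. True}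
    \<union> {pt (x, y + y') - pt (x, y) - pt (x, y') | x y y'. True}
    \<union> {pt (sA r x, y) - free_scale r (pt (x, y)) | r x y. True}
    \<union> {pt (x, sB r y) - free_scale r (pt (x, y)) | r x y. True}"

definition tensor_product ::
    "('k::field \<Rightarrow> 'a::ab_group_add \<Rightarrow> 'a) \<Rightarrow> ('k \<Rightarrow> 'b::ab_group_add \<Rightarrow> 'b) \<Rightarrow>
     ('k \<Rightarrow> 'x::ab_group_add \<Rightarrow> 'x) \<Rightarrow> ('a \<Rightarrow> 'b \<Rightarrow> 'x) \<Rightarrow> bool"
  where "tensor_product sA sB sX \<tau> \<longleftrightarrow>
      vector_space sA \<and> vector_space sB \<and> vector_space sX \<and>
      surj (free_extend sX (case_prod \<tau>)) \<and>
      {p. free_extend sX (case_prod \<tau>) p = 0} = module.span free_scale (bilinear_relations sA sB)"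

text \<open>
  \<open>tensor_lift_on A B sX \<tau> sY \<beta>\<close> is a linear map sending \<open>x \<otimes> y\<close> to \<open>\<beta> x y\<close> for \<open>x \<in> A\<close> and \<open>y \<in> B\<close>.
  If \<open>A\<close>, \<open>B\<close> are subspaces and \<open>\<beta>\<close> is bilinear on \<open>A \<times> B\<close>, such a map exists, and it is uniquely
  determined on the subspace \<open>A \<otimes> B\<close>.
\<close>

definition tensor_lift_on ::
    "'a set \<Rightarrow> 'b set \<Rightarrow> ('k::field \<Rightarrow> 'x::ab_group_add \<Rightarrow> 'x) \<Rightarrow> ('a \<Rightarrow> 'b \<Rightarrow> 'x) \<Rightarrow>
     ('k \<Rightarrow> 'y::ab_group_add \<Rightarrow> 'y) \<Rightarrow> ('a \<Rightarrow> 'b \<Rightarrow> 'y) \<Rightarrow> 'x \<Rightarrow> 'y"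
  where "tensor_lift_on A B sX \<tau> sY \<beta> =
    (SOME h. Vector_Spaces.linear sX sY h \<and> (\<forall>x\<in>A. \<forall>y\<in>B. h (\<tau> x y) = \<beta> x y))"

abbreviation tensor_lift ::
    "('k::field \<Rightarrow> 'x::ab_group_add \<Rightarrow> 'x) \<Rightarrow> ('a \<Rightarrow> 'b \<Rightarrow> 'x) \<Rightarrow>
     ('k \<Rightarrow> 'y::ab_group_add \<Rightarrow> 'y) \<Rightarrow> ('a \<Rightarrow> 'b \<Rightarrow> 'y) \<Rightarrow> 'x \<Rightarrow> 'y"
  where "tensor_lift \<equiv> tensor_lift_on UNIV UNIV"

text \<open>The map \<open>f \<otimes> g\<close>, from the tensor product \<open>(X, \<tau>)\<close> to the tensor product \<open>(Y, \<tau>')\<close>.\<close>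

abbreviation tensor_map ::
    "('k::field \<Rightarrow> 'x::ab_group_add \<Rightarrow> 'x) \<Rightarrow> ('a \<Rightarrow> 'b \<Rightarrow> 'x) \<Rightarrow>
     ('k \<Rightarrow> 'y::ab_group_add \<Rightarrow> 'y) \<Rightarrow> ('c \<Rightarrow> 'd \<Rightarrow> 'y) \<Rightarrow> ('a \<Rightarrow> 'c) \<Rightarrow> ('b \<Rightarrow> 'd) \<Rightarrow> 'x \<Rightarrow> 'y"
  where "tensor_map sX \<tau> sY \<tau>' f g \<equiv> tensor_lift sX \<tau> sY (\<lambda>x y. \<tau>' (f x) (g y))"

text \<open>
  A vector space \<open>A\<close> with its second and third tensor powers.  The latter is both
  \<open>(A \<otimes> A) \<otimes> A\<close> and \<open>A \<otimes> (A \<otimes> A)\<close>, the associativity isomorphism being the identity.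
\<close>

record ('k, 'a, 'a2, 'a3) cube_data =
  sc :: "'k \<Rightarrow> 'a \<Rightarrow> 'a"
  sc2 :: "'k \<Rightarrow> 'a2 \<Rightarrow> 'a2"
  sc3 :: "'k \<Rightarrow> 'a3 \<Rightarrow> 'a3"
  tens :: "'a \<Rightarrow> 'a \<Rightarrow> 'a2"
  tens21 :: "'a2 \<Rightarrow> 'a \<Rightarrow> 'a3"
  tens12 :: "'a \<Rightarrow> 'a2 \<Rightarrow> 'a3"

record ('k, 'a, 'a2, 'a3, 'a4) fourth_data = "('k, 'a, 'a2, 'a3) cube_data" +
  sc4 :: "'k \<Rightarrow> 'a4 \<Rightarrow> 'a4"
  tens22 :: "'a2 \<Rightarrow> 'a2 \<Rightarrow> 'a4"
  tens13 :: "'a \<Rightarrow> 'a3 \<Rightarrow> 'a4"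

locale tensor_cube =
  fixes A :: "('k::field, 'a::ab_group_add, 'a2::ab_group_add, 'a3::ab_group_add, 'm) cube_data_scheme"
  assumes tensor_11: "tensor_product (sc A) (sc A) (sc2 A) (tens A)"
    and tensor_21: "tensor_product (sc2 A) (sc A) (sc3 A) (tens21 A)"
    and tensor_12: "tensor_product (sc A) (sc2 A) (sc3 A) (tens12 A)"
    and tens_assoc: "tens21 A (tens A x y) z = tens12 A x (tens A y z)"

locale tensor_fourth = tensor_cube A
  for A :: "('k::field, 'a::ab_group_add, 'a2::ab_group_add, 'a3::ab_group_add, 'a4::ab_group_add, 'm)
      fourth_data_scheme" +
  assumes tensor_22: "tensor_product (sc2 A) (sc2 A) (sc4 A) (tens22 A)"
    and tensor_13: "tensor_product (sc A) (sc3 A) (sc4 A) (tens13 A)"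
    and tens_assoc4: "tens22 A (tens A x y) (tens A z w) = tens13 A x (tens12 A y (tens A z w))"

section \<open>Braided vector spaces and braided bialgebras\<close>

text \<open>\<open>c \<otimes> A\<close> and \<open>A \<otimes> c\<close> on the third tensor power.\<close>

definition act12 ::
    "('k::field, 'a, 'a2, 'a3::ab_group_add, 'm) cube_data_scheme \<Rightarrow> ('a2 \<Rightarrow> 'a2) \<Rightarrow> 'a3 \<Rightarrow> 'a3"
  where "act12 A c = tensor_map (sc3 A) (tens21 A) (sc3 A) (tens21 A) c id"

definition act23 ::
    "('k::field, 'a, 'a2, 'a3::ab_group_add, 'm) cube_data_scheme \<Rightarrow> ('a2 \<Rightarrow> 'a2) \<Rightarrow> 'a3 \<Rightarrow> 'a3"
  where "act23 A c = tensor_map (sc3 A) (tens12 A) (sc3 A) (tens12 A) id c"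

locale braided_vector_space = tensor_cube A
  for A :: "('k::field, 'a::ab_group_add, 'a2::ab_group_add, 'a3::ab_group_add, 'm) cube_data_scheme" +
  fixes c :: "'a2 \<Rightarrow> 'a2"
  assumes linear_braiding: "Vector_Spaces.linear (sc2 A) (sc2 A) c"
    and braid_equation:
      "act12 A c \<circ> act23 A c \<circ> act12 A c = act23 A c \<circ> act12 A c \<circ> act23 A c"

definition hecke_type ::
    "('k::field, 'a, 'a2::ab_group_add, 'a3, 'm) cube_data_scheme \<Rightarrow> ('a2 \<Rightarrow> 'a2) \<Rightarrow> 'k \<Rightarrow> bool"
  where "hecke_type A c q \<longleftrightarrow>
    q \<noteq> 0 \<and> (\<forall>z. c (c z - sc2 A q z) + (c z - sc2 A q z) = 0)"

definition regular_mark :: "'k::field \<Rightarrow> bool"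
  where "regular_mark q \<longleftrightarrow> (\<forall>n\<ge>2. (\<Sum>i<n. q ^ i) \<noteq> 0)"

definition mult_left ::
    "('k::field, 'a, 'a2::ab_group_add, 'a3::ab_group_add, 'm) cube_data_scheme \<Rightarrow> ('a2 \<Rightarrow> 'a) \<Rightarrow> 'a3 \<Rightarrow> 'a2"
  where "mult_left A m = tensor_map (sc3 A) (tens21 A) (sc2 A) (tens A) m id"

definition mult_right ::
    "('k::field, 'a, 'a2::ab_group_add, 'a3::ab_group_add, 'm) cube_data_scheme \<Rightarrow> ('a2 \<Rightarrow> 'a) \<Rightarrow> 'a3 \<Rightarrow> 'a2"
  where "mult_right A m = tensor_map (sc3 A) (tens12 A) (sc2 A) (tens A) id m"

definition comult_left ::
    "('k::field, 'a, 'a2::ab_group_add, 'a3::ab_group_add, 'm) cube_data_scheme \<Rightarrow> ('a \<Rightarrow> 'a2) \<Rightarrow> 'a2 \<Rightarrow> 'a3"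
  where "comult_left A \<Delta> = tensor_map (sc2 A) (tens A) (sc3 A) (tens21 A) \<Delta> id"

definition comult_right ::
    "('k::field, 'a, 'a2::ab_group_add, 'a3::ab_group_add, 'm) cube_data_scheme \<Rightarrow> ('a \<Rightarrow> 'a2) \<Rightarrow> 'a2 \<Rightarrow> 'a3"
  where "comult_right A \<Delta> = tensor_map (sc2 A) (tens A) (sc3 A) (tens12 A) id \<Delta>"

text \<open>\<open>\<epsilon> \<otimes> A\<close> and \<open>A \<otimes> \<epsilon>\<close>, with \<open>K \<otimes> A\<close> and \<open>A \<otimes> K\<close> identified with \<open>A\<close>.\<close>

definition counit_left ::
    "('k::field, 'a::ab_group_add, 'a2::ab_group_add, 'a3, 'm) cube_data_scheme \<Rightarrow> ('a \<Rightarrow> 'k) \<Rightarrow> 'a2 \<Rightarrow> 'a"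
  where "counit_left A \<epsilon> = tensor_lift (sc2 A) (tens A) (sc A) (\<lambda>x y. sc A (\<epsilon> x) y)"

definition counit_right ::
    "('k::field, 'a::ab_group_add, 'a2::ab_group_add, 'a3, 'm) cube_data_scheme \<Rightarrow> ('a \<Rightarrow> 'k) \<Rightarrow> 'a2 \<Rightarrow> 'a"
  where "counit_right A \<epsilon> = tensor_lift (sc2 A) (tens A) (sc A) (\<lambda>x y. sc A (\<epsilon> y) x)"

locale braided_bialgebra =
  tensor_fourth B + braided_vector_space B c
  for B :: "('k::field, 'b::ab_group_add, 'b2::ab_group_add, 'b3::ab_group_add, 'b4::ab_group_add, 'm)
      fourth_data_scheme"
    and m :: "'b2 \<Rightarrow> 'b" and u :: "'k \<Rightarrow> 'b" and \<Delta> :: "'b \<Rightarrow> 'b2" and \<epsilon> :: "'b \<Rightarrow> 'k"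
    and c :: "'b2 \<Rightarrow> 'b2" +
  assumes linear_m: "Vector_Spaces.linear (sc2 B) (sc B) m"
    and linear_u: "Vector_Spaces.linear (*) (sc B) u"
    and assoc: "m \<circ> mult_left B m = m \<circ> mult_right B m"
    and unit_left: "m (tens B (u r) x) = sc B r x"
    and unit_right: "m (tens B x (u r)) = sc B r x"
    and linear_\<Delta>: "Vector_Spaces.linear (sc B) (sc2 B) \<Delta>"
    and linear_\<epsilon>: "Vector_Spaces.linear (sc B) (*) \<epsilon>"
    and coassoc: "comult_left B \<Delta> \<circ> \<Delta> = comult_right B \<Delta> \<circ> \<Delta>"
    and counital_left: "counit_left B \<epsilon> \<circ> \<Delta> = id"
    and counital_right: "counit_right B \<epsilon> \<circ> \<Delta> = id"
    and c_mult_left: "c \<circ> mult_left B m = mult_right B m \<circ> act12 B c \<circ> act23 B c"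
    and c_mult_right: "c \<circ> mult_right B m = mult_left B m \<circ> act23 B c \<circ> act12 B c"
    and c_unit_left: "c (tens B (u r) x) = tens B x (u r)"
    and c_unit_right: "c (tens B x (u r)) = tens B (u r) x"
    and comult_left_c: "comult_left B \<Delta> \<circ> c = act23 B c \<circ> act12 B c \<circ> comult_right B \<Delta>"
    and comult_right_c: "comult_right B \<Delta> \<circ> c = act12 B c \<circ> act23 B c \<circ> comult_left B \<Delta>"
    and counit_left_c: "counit_left B \<epsilon> \<circ> c = counit_right B \<epsilon>"
    and counit_right_c: "counit_right B \<epsilon> \<circ> c = counit_left B \<epsilon>"
    and \<Delta>_m: "\<Delta> \<circ> m =
        tensor_map (sc4 B) (tens22 B) (sc2 B) (tens B) m m
      \<circ> tensor_map (sc4 B) (tens13 B) (sc4 B) (tens13 B) id (act12 B c)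
      \<circ> tensor_map (sc2 B) (tens B) (sc4 B) (tens22 B) \<Delta> \<Delta>"
    and \<Delta>_unit: "\<Delta> (u 1) = tens B (u 1) (u 1)"
    and \<epsilon>_unit: "\<epsilon> (u 1) = 1"
    and \<epsilon>_m: "\<epsilon> (m (tens B x y)) = \<epsilon> x * \<epsilon> y"

section \<open>The braided tensor algebra\<close>

definition multilinear_relations ::
    "('k::field \<Rightarrow> 'v::ab_group_add \<Rightarrow> 'v) \<Rightarrow> ('v list \<Rightarrow>\<^sub>0 'k) set"
  where "multilinear_relations s =
      {pt (xs @ (v + w) # ys) - pt (xs @ v # ys) - pt (xs @ w # ys) | xs v w ys. True}
    \<union> {pt (xs @ s r v # ys) - free_scale r (pt (xs @ v # ys)) | xs r v ys. True}"

text \<open>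
  The tensor algebra \<open>\<Oplus>\<^sub>n V\<^sup>\<otimes>\<^sup>n\<close>: the quotient of the free vector space on all finite sequences of
  vectors by the multilinearity relations, with the concatenation product.
\<close>

locale tensor_algebra =
  fixes s :: "'k::field \<Rightarrow> 'v::ab_group_add \<Rightarrow> 'v"
    and sT :: "'k \<Rightarrow> 't::ring_1 \<Rightarrow> 't"
    and \<iota> :: "'v \<Rightarrow> 't"
  assumes space_V: "vector_space s"
    and space_T: "vector_space sT"
    and scale_mult_left: "sT r (x * y) = sT r x * y"
    and scale_mult_right: "sT r (x * y) = x * sT r y"
    and words_surj: "surj (free_extend sT (\<lambda>vs. prod_list (map \<iota> vs)))"
    and words_kernel: "{p. free_extend sT (\<lambda>vs. prod_list (map \<iota> vs)) p = 0} =
      module.span free_scale (multilinear_relations s)"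

text \<open>
  \<open>T(V, c)\<close> with its braided bialgebra structure: the product and unit are those of the tensor
  algebra, and \<open>cT\<close>, \<open>\<Delta>\<close>, \<open>\<epsilon>\<close> are pinned down by the two final conditions.
\<close>

locale braided_tensor_algebra =
  V: braided_vector_space V c + tensor_algebra "sc V" "sc T" \<iota> +
  T: braided_bialgebra T "tensor_lift (sc2 T) (tens T) (sc T) (*)" "\<lambda>r. sc T r 1" \<Delta> \<epsilon> cT
  for V :: "('k::field, 'v::ab_group_add, 'v2::ab_group_add, 'v3::ab_group_add) cube_data"
    and c :: "'v2 \<Rightarrow> 'v2"
    and T :: "('k, 't::ring_1, 't2::ab_group_add, 't3::ab_group_add, 't4::ab_group_add) fourth_data"
    and \<iota> :: "'v \<Rightarrow> 't"
    and \<Delta> :: "'t \<Rightarrow> 't2" and \<epsilon> :: "'t \<Rightarrow> 'k" and cT :: "'t2 \<Rightarrow> 't2" +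
  assumes cT_extends: "cT (tens T (\<iota> v) (\<iota> w)) =
      tensor_map (sc2 V) (tens V) (sc2 T) (tens T) \<iota> \<iota> (c (tens V v w))"
    and primitive: "\<Delta> (\<iota> v) = tens T (\<iota> v) 1 + tens T 1 (\<iota> v)"

definition degree_part :: "('k::field \<Rightarrow> 't::ring_1 \<Rightarrow> 't) \<Rightarrow> ('v \<Rightarrow> 't) \<Rightarrow> nat \<Rightarrow> 't set"
  where "degree_part sT \<iota> n = module.span sT {prod_list (map \<iota> vs) | vs. length vs = n}"

text \<open>The projection of \<open>T = \<Oplus>\<^sub>n T\<^sup>n\<close> onto its component of degree \<open>n\<close>.\<close>

definition degree_proj :: "('k::field \<Rightarrow> 't::ring_1 \<Rightarrow> 't) \<Rightarrow> ('v \<Rightarrow> 't) \<Rightarrow> nat \<Rightarrow> 't \<Rightarrow> 't"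
  where "degree_proj sT \<iota> n = (THE p. Vector_Spaces.linear sT sT p \<and>
    (\<forall>vs. p (prod_list (map \<iota> vs)) = (if length vs = n then prod_list (map \<iota> vs) else 0)))"

text \<open>
  \<open>\<Delta>\<^sup>a\<^sup>,\<^sup>b\<close> is the composition of \<open>\<Delta>\<close> with the projection of \<open>T \<otimes> T\<close> onto \<open>T\<^sup>a \<otimes> T\<^sup>b\<close>.
\<close>

definition comult_part ::
    "('k::field, 't::ring_1, 't2::ab_group_add, 't3, 'm) cube_data_scheme \<Rightarrow>
     ('v \<Rightarrow> 't) \<Rightarrow> ('t \<Rightarrow> 't2) \<Rightarrow> nat \<Rightarrow> nat \<Rightarrow> 't \<Rightarrow> 't2"
  where "comult_part T \<iota> \<Delta> a b =
    tensor_map (sc2 T) (tens T) (sc2 T) (tens T) (degree_proj (sc T) \<iota> a) (degree_proj (sc T) \<iota> b) \<circ> \<Delta>"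

definition E_part ::
    "('k::field, 't::ring_1, 't2::ab_group_add, 't3, 'm) cube_data_scheme \<Rightarrow>
     ('v \<Rightarrow> 't) \<Rightarrow> ('t \<Rightarrow> 't2) \<Rightarrow> nat \<Rightarrow> 't set"
  where "E_part T \<iota> \<Delta> n = {x \<in> degree_part (sc T) \<iota> n.
    \<forall>a\<ge>1. \<forall>b\<ge>1. a + b = n \<longrightarrow> comult_part T \<iota> \<Delta> a b x = 0}"

definition E_space ::
    "('k::field, 't::ring_1, 't2::ab_group_add, 't3, 'm) cube_data_scheme \<Rightarrow>
     ('v \<Rightarrow> 't) \<Rightarrow> ('t \<Rightarrow> 't2) \<Rightarrow> 't set"
  where "E_space T \<iota> \<Delta> = module.span (sc T) (\<Union>n\<in>{2..}. E_part T \<iota> \<Delta> n)"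

section \<open>Brackets and enveloping algebras\<close>

text \<open>
  A bracket is a function on the whole of \<open>T\<close> of which only the restriction to \<open>E(V, c)\<close> matters.
  The subspaces \<open>E(V, c) \<otimes> V\<close> and \<open>V \<otimes> E(V, c)\<close> are taken inside \<open>T \<otimes> T\<close>, with \<open>V\<close> embedded in
  \<open>T\<close> by \<open>\<iota>\<close>; on them the maps \<open>b \<otimes> V\<close> and \<open>V \<otimes> b\<close> to \<open>V \<otimes> V\<close> are determined.
\<close>

definition is_bracket ::
    "('k::field, 'v::ab_group_add, 'v2::ab_group_add, 'v3, 'm) cube_data_scheme \<Rightarrow> ('v2 \<Rightarrow> 'v2) \<Rightarrow>
     ('k, 't::ring_1, 't2::ab_group_add, 't3, 'n) cube_data_scheme \<Rightarrow>
     ('v \<Rightarrow> 't) \<Rightarrow> ('t \<Rightarrow> 't2) \<Rightarrow> ('t2 \<Rightarrow> 't2) \<Rightarrow> ('t \<Rightarrow> 'v) \<Rightarrow> bool"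
  where "is_bracket V c T \<iota> \<Delta> cT b \<longleftrightarrow>
    (let E = E_space T \<iota> \<Delta>;
         EV = module.span (sc2 T) {tens T x (\<iota> v) | x v. x \<in> E};
         VE = module.span (sc2 T) {tens T (\<iota> v) x | v x. x \<in> E};
         bV = tensor_lift_on E (range \<iota>) (sc2 T) (tens T) (sc2 V) (\<lambda>x w. tens V (b x) (inv \<iota> w));
         Vb = tensor_lift_on (range \<iota>) E (sc2 T) (tens T) (sc2 V) (\<lambda>w x. tens V (inv \<iota> w) (b x))
     in (\<forall>x\<in>E. \<forall>y\<in>E. b (x + y) = b x + b y) \<and>
        (\<forall>r. \<forall>x\<in>E. b (sc T r x) = sc V r (b x)) \<and>
        (\<forall>z\<in>EV. c (bV z) = Vb (cT z)) \<and>
        (\<forall>z\<in>VE. c (Vb z) = bV (cT z)))"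

definition two_sided_ideal :: "'t::ring_1 set \<Rightarrow> bool"
  where "two_sided_ideal I \<longleftrightarrow>
    0 \<in> I \<and> (\<forall>x\<in>I. \<forall>y\<in>I. x + y \<in> I) \<and> (\<forall>a. \<forall>x\<in>I. a * x \<in> I \<and> x * a \<in> I)"

definition ideal_coset :: "'t::ring_1 set \<Rightarrow> 't \<Rightarrow> 't set"
  where "ideal_coset I x = {x + i | i. i \<in> I}"

record ('k, 'q) algebra_structure =
  alg_carrier :: "'q set"
  alg_zero :: 'q
  alg_one :: 'q
  alg_add :: "'q \<Rightarrow> 'q \<Rightarrow> 'q"
  alg_mult :: "'q \<Rightarrow> 'q \<Rightarrow> 'q"
  alg_scale :: "'k \<Rightarrow> 'q \<Rightarrow> 'q"

definition quotient_algebra ::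
    "('k \<Rightarrow> 't::ring_1 \<Rightarrow> 't) \<Rightarrow> 't set \<Rightarrow> ('k, 't set) algebra_structure"
  where "quotient_algebra sT I =
    \<lparr> alg_carrier = range (ideal_coset I),
      alg_zero = ideal_coset I 0,
      alg_one = ideal_coset I 1,
      alg_add = (\<lambda>X Y. \<Union>x\<in>X. \<Union>y\<in>Y. ideal_coset I (x + y)),
      alg_mult = (\<lambda>X Y. \<Union>x\<in>X. \<Union>y\<in>Y. ideal_coset I (x * y)),
      alg_scale = (\<lambda>r X. \<Union>x\<in>X. ideal_coset I (sT r x)) \<rparr>"

definition enveloping_ideal ::
    "('k::field, 't::ring_1, 't2::ab_group_add, 't3, 'm) cube_data_scheme \<Rightarrow>
     ('v \<Rightarrow> 't) \<Rightarrow> ('t \<Rightarrow> 't2) \<Rightarrow> ('t \<Rightarrow> 'v) \<Rightarrow> 't set"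
  where "enveloping_ideal T \<iota> \<Delta> b = two_sided_ideal hull ((\<lambda>x. x - \<iota> (b x)) ` E_space T \<iota> \<Delta>)"

definition enveloping_algebra ::
    "('k::field, 't::ring_1, 't2::ab_group_add, 't3, 'm) cube_data_scheme \<Rightarrow>
     ('v \<Rightarrow> 't) \<Rightarrow> ('t \<Rightarrow> 't2) \<Rightarrow> ('t \<Rightarrow> 'v) \<Rightarrow> ('k, 't set) algebra_structure"
  where "enveloping_algebra T \<iota> \<Delta> b = quotient_algebra (sc T) (enveloping_ideal T \<iota> \<Delta> b)"

definition i_U ::
    "('k::field, 't::ring_1, 't2::ab_group_add, 't3, 'm) cube_data_scheme \<Rightarrow>
     ('v \<Rightarrow> 't) \<Rightarrow> ('t \<Rightarrow> 't2) \<Rightarrow> ('t \<Rightarrow> 'v) \<Rightarrow> 'v \<Rightarrow> 't set"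
  where "i_U T \<iota> \<Delta> b v = ideal_coset (enveloping_ideal T \<iota> \<Delta> b) (\<iota> v)"

locale braided_lie_algebra = braided_tensor_algebra V c T \<iota> \<Delta> \<epsilon> cT
  for V :: "('k::field, 'v::ab_group_add, 'v2::ab_group_add, 'v3::ab_group_add) cube_data"
    and c :: "'v2 \<Rightarrow> 'v2"
    and T :: "('k, 't::ring_1, 't2::ab_group_add, 't3::ab_group_add, 't4::ab_group_add) fourth_data"
    and \<iota> :: "'v \<Rightarrow> 't"
    and \<Delta> :: "'t \<Rightarrow> 't2" and \<epsilon> :: "'t \<Rightarrow> 'k" and cT :: "'t2 \<Rightarrow> 't2" +
  fixes b :: "'t \<Rightarrow> 'v"
  assumes bracket: "is_bracket V c T \<iota> \<Delta> cT b"
    and i_U_inj: "inj (i_U T \<iota> \<Delta> b)"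

text \<open>The identification of \<open>V \<otimes> V\<close> with the degree two component of the tensor algebra.\<close>

definition tens2_incl ::
    "('k::field, 'v::ab_group_add, 'v2::ab_group_add, 'v3, 'm) cube_data_scheme \<Rightarrow>
     ('k \<Rightarrow> 't::ring_1 \<Rightarrow> 't) \<Rightarrow> ('v \<Rightarrow> 't) \<Rightarrow> 'v2 \<Rightarrow> 't"
  where "tens2_incl V sT \<iota> = tensor_lift (sc2 V) (tens V) sT (\<lambda>v w. \<iota> v * \<iota> w)"

definition hecke_bracket ::
    "('k::field, 'v::ab_group_add, 'v2::ab_group_add, 'v3, 'm) cube_data_scheme \<Rightarrow> ('v2 \<Rightarrow> 'v2) \<Rightarrow>
     ('k \<Rightarrow> 't::ring_1 \<Rightarrow> 't) \<Rightarrow> ('v \<Rightarrow> 't) \<Rightarrow> ('t \<Rightarrow> 'v) \<Rightarrow> 'k \<Rightarrow> 'v2 \<Rightarrow> 'v"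
  where "hecke_bracket V c sT \<iota> b q z = b (tens2_incl V sT \<iota> (c z - sc2 V q z))"

end

theory Submission
  imports Defs
begin

text \<open>
  Write \<open>R = im (c - q) \<subseteq> V \<otimes> V\<close>, let \<open>I\<close> be the ideal defining the enveloping algebra and \<open>J\<close> the
  ideal generated by the elements \<open>r - b r\<close> with \<open>r \<in> R\<close>.  By the Hecke equation
  \<open>R \<subseteq> ker (c + 1) = E\<^sub>2\<close>, so \<open>J \<subseteq> I\<close>.  The content of the first claim is that \<open>x - b x \<in> J\<close> for every
  \<open>x \<in> E\<^sub>n\<close>, \<open>n \<ge> 2\<close>.

  The braid equation and the compatibility of \<open>b\<close> with \<open>c\<close> show that the braiding of the tensor
  algebra exchanges \<open>J \<otimes> T\<close> and \<open>T \<otimes> J\<close>.  As the generators of \<open>J\<close> are primitive, \<open>J\<close> is a coideal: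
  \<open>\<Delta> J \<subseteq> J \<otimes> T + T \<otimes> J\<close> (\<open>Delta_J\<close>).  The elements of \<open>E\<^sub>n\<close> are the primitive elements of degree
  \<open>n\<close> (\<open>E_part_primitive_iff\<close>), so it suffices to prove that an element of \<open>T\<close> that is primitive
  modulo \<open>J\<close> lies in \<open>V + J\<close> (\<open>prim_V\<close>): if then \<open>x \<equiv> v\<close> modulo \<open>J\<close>, the elements \<open>v\<close> and \<open>b x\<close> are
  equal modulo \<open>I\<close>, hence equal because \<open>V\<close> embeds into the enveloping algebra.

  The key to \<open>prim_V\<close> is a computation in the tensor algebra (\<open>Delta_word\<close>): for \<open>w\<close> of degree \<open>n\<close>,
  multiplying the component of \<open>\<Delta> w\<close> in \<open>V \<otimes> V\<^sup>\<otimes>\<^sup>(\<^sup>n\<^sup>-\<^sup>1\<^sup>)\<close> back together gives \<open>(n)\<^sub>q w\<close> modulo the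
  ideal generated by \<open>R\<close>, since modulo that ideal \<open>c\<close> acts on adjacent factors as \<open>q\<close>.
  Let \<open>w + l\<close> be primitive modulo \<open>J\<close>, with \<open>w\<close> of degree \<open>n \<ge> 2\<close> and \<open>l\<close> of smaller degree.  Reading
  off this component of \<open>\<Delta> (w + l)\<close> modulo \<open>J \<otimes> T + T \<otimes> J\<close> gives zero, so \<open>(n)\<^sub>q w\<close>, and by regularity
  \<open>w\<close>, lies in the ideal \<open>(R)\<close> (\<open>leading_term_prim\<close>).  That the component can be read off needs the
  same statement for elements of \<open>J\<close> in degree \<open>n - 1\<close>; since elements of \<open>J\<close> are primitive modulo
  \<open>J\<close>, both statements are proved together by induction on the degree, starting from \<open>V \<inter> J = 0\<close>.
  Once \<open>w \<in> (R)\<close>, it is congruent modulo \<open>J\<close> to an element of degree \<open>n - 1\<close>, and descent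
  on the degree proves \<open>prim_V\<close>.

  For the second claim put \<open>\<beta> = [-]\<^sub>b\<close>.  Then \<open>\<beta> c = -\<beta>\<close>, and \<open>c (\<beta> \<otimes> V) = (V \<otimes> \<beta>) c\<^sub>1 c\<^sub>2\<close>,
  \<open>c (V \<otimes> \<beta>) = (\<beta> \<otimes> V) c\<^sub>2 c\<^sub>1\<close>.  Together with the quadratic and the braid equation these force
  \<open>\<beta> \<otimes> V = - V \<otimes> \<beta>\<close> when \<open>q \<noteq> 1\<close> (\<open>betaV_eq_minus_Vbeta\<close>).  If some \<open>\<beta> (x \<otimes> y)\<close> were nonzero, a linear
  functional applied to this equation would give \<open>\<beta> (y \<otimes> y) = \<mu> y\<close> with \<open>\<mu> \<noteq> 0\<close>, hence
  \<open>\<mu> (y \<otimes> y) = - \<mu> (y \<otimes> y)\<close>, which is impossible if \<open>2 \<noteq> 0\<close> (\<open>beta_zero\<close>).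
\<close>

section \<open>Linear maps out of quotients of free vector spaces\<close>

lemma lookup_free_scale: "Poly_Mapping.lookup (free_scale r p) x = r * Poly_Mapping.lookup p x"
  unfolding free_scale_def by (simp add: Poly_Mapping.map.rep_eq when_def)

lemma vector_space_free_scale: "vector_space free_scale"
  by unfold_locales
    (rule poly_mapping_eqI; simp add: lookup_free_scale lookup_add algebra_simps)+

lemma free_extend_superset:
  assumes "vector_space s" "finite K" "Poly_Mapping.keys p \<subseteq> K"
  shows "free_extend s f p = (\<Sum>x\<in>K. s (Poly_Mapping.lookup p x) (f x))"
proof -
  interpret vector_space s by fact
  show ?thesis
    unfolding free_extend_def using assms(2,3)
    by (intro sum.mono_neutral_left) (auto simp: in_keys_iff)
qed

lemma linear_free_extend:
  assumes "vector_space s"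
  shows "Vector_Spaces.linear free_scale s (free_extend s f)"
proof -
  interpret vector_space s by fact
  have "free_extend s f (p + p') = free_extend s f p + free_extend s f p'" for p p'
  proof -
    let ?K = "Poly_Mapping.keys p \<union> Poly_Mapping.keys p'"
    have "Poly_Mapping.keys (p + p') \<subseteq> ?K" by (rule Poly_Mapping.keys_add)
    then show ?thesis
      using free_extend_superset[OF assms, of ?K "p + p'" f] free_extend_superset[OF assms, of ?K p f]
        free_extend_superset[OF assms, of ?K p' f]
      by (simp add: lookup_add scale_left_distrib sum.distrib)
  qed
  moreover have "free_extend s f (free_scale r p) = s r (free_extend s f p)" for r p
  proof -
    have "Poly_Mapping.keys (free_scale r p) \<subseteq> Poly_Mapping.keys p"
      by (auto simp: in_keys_iff lookup_free_scale)
    then show ?thesis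
      using free_extend_superset[OF assms, of "Poly_Mapping.keys p" "free_scale r p" f]
      by (simp add: free_extend_def lookup_free_scale scale_sum_right)
  qed
  ultimately show ?thesis
    unfolding Vector_Spaces.linear_iff using assms vector_space_free_scale by blast
qed

lemma free_extend_pt:
  assumes "vector_space s" shows "free_extend s f (pt x) = f x"
  using assms unfolding free_extend_def vector_space_def by simp

lemma free_extend_image:
  assumes "vector_space s"
  shows "free_extend s f p \<in> module.span s (range f)"
proof -
  interpret vector_space s by fact
  show ?thesis unfolding free_extend_def
    by (intro span_sum span_scale span_base) auto
qed

text \<open>
  A presentation of \<open>sX\<close> by generators \<open>g\<close> and relations \<open>R\<close> has the universal property of a
  quotient: a linear map on \<open>sX\<close> may be prescribed on generators as soon as it respects \<open>R\<close>.
\<close>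

lemma linear_map_of_presentation:
  assumes X: "vector_space sX" and Y: "vector_space sY"
    and onto: "surj (free_extend sX g)"
    and kernel: "{p. free_extend sX g p = 0} = module.span free_scale R"
    and relations: "\<And>p. p \<in> R \<Longrightarrow> free_extend sY h p = 0"
  shows "\<exists>H. Vector_Spaces.linear sX sY H \<and> (\<forall>x. H (g x) = h x)"
proof -
  interpret F: vector_space "free_scale :: 'a \<Rightarrow> ('c \<Rightarrow>\<^sub>0 'a) \<Rightarrow> _" by (rule vector_space_free_scale)
  interpret GX: Vector_Spaces.linear free_scale sX "free_extend sX g" by (rule linear_free_extend[OF X])
  interpret HY: Vector_Spaces.linear free_scale sY "free_extend sY h" by (rule linear_free_extend[OF Y])
  have zero: "free_extend sY h p = 0" if "free_extend sX g p = 0" for p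
  proof -
    have "p \<in> module.span free_scale R" using that kernel by blast
    then show ?thesis
      by (rule HY.eq_0_on_span[rotated]) (rule relations)
  qed
  define sec where "sec z = (SOME p. free_extend sX g p = z)" for z
  have sec: "free_extend sX g (sec z) = z" for z
    unfolding sec_def using onto by (metis (mono_tags, lifting) someI_ex surjD)
  define H where "H z = free_extend sY h (sec z)" for z
  have H: "H (free_extend sX g p) = free_extend sY h p" for p
  proof -
    have "free_extend sY h (sec (free_extend sX g p) - p) = 0"
      by (intro zero) (simp add: GX.diff sec)
    then show ?thesis by (simp add: H_def HY.diff)
  qed
  have "H (z + z') = H z + H z'" for z z'
    using H[of "sec z + sec z'"] by (simp add: GX.add HY.add sec H_def)
  moreover have "H (sX r z) = sY r (H z)" for r z
    using H[of "free_scale r (sec z)"] by (simp add: GX.scale HY.scale sec H_def)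
  moreover have "H (g x) = h x" for x
    using H[of "pt x"] by (simp add: free_extend_pt X Y)
  ultimately show ?thesis
    using X Y unfolding Vector_Spaces.linear_iff by blast
qed

section \<open>Extension and projection of linear maps\<close>

lemma linear_rules:
  assumes "Vector_Spaces.linear s1 s2 f"
  shows "f (x + y) = f x + f y" "f (s1 r x) = s2 r (f x)" "f 0 = 0" "f (x - y) = f x - f y" "f (- x) = - f x"
proof -
  interpret Vector_Spaces.linear s1 s2 f by fact
  show "f (x + y) = f x + f y" "f (s1 r x) = s2 r (f x)" "f 0 = 0" "f (x - y) = f x - f y" "f (- x) = - f x"
    by (simp_all add: add scale diff neg)
qed

lemma linear_comp:
  assumes "Vector_Spaces.linear s1 s2 f" "Vector_Spaces.linear s2 s3 g"
  shows "Vector_Spaces.linear s1 s3 (\<lambda>x. g (f x))"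
  using assms unfolding Vector_Spaces.linear_iff by simp

lemma linear_plus_minus:
  assumes "Vector_Spaces.linear s1 s2 f" "Vector_Spaces.linear s1 s2 g"
  shows "Vector_Spaces.linear s1 s2 (\<lambda>x. f x + g x)" "Vector_Spaces.linear s1 s2 (\<lambda>x. f x - g x)"
    "Vector_Spaces.linear s1 s2 (\<lambda>x. s2 r (f x))"
proof -
  interpret f: Vector_Spaces.linear s1 s2 f by fact
  interpret g: Vector_Spaces.linear s1 s2 g by fact
  show "Vector_Spaces.linear s1 s2 (\<lambda>x. f x + g x)" "Vector_Spaces.linear s1 s2 (\<lambda>x. f x - g x)"
    "Vector_Spaces.linear s1 s2 (\<lambda>x. s2 r (f x))"
    unfolding Vector_Spaces.linear_iff using f.vs1.vector_space_axioms f.vs2.vector_space_axioms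
    by (auto simp: f.add g.add f.scale g.scale algebra_simps f.vs2.scale_right_distrib
        f.vs2.scale_right_diff_distrib)
qed

lemma linear_identity:
  assumes "vector_space s"
  shows "Vector_Spaces.linear s s id" "Vector_Spaces.linear s s (\<lambda>x. x)"
  using assms unfolding Vector_Spaces.linear_iff by simp_all

lemma linear_span_into:
  assumes "Vector_Spaces.linear s1 s2 f" "module.subspace s2 W"
    and "\<And>x. x \<in> S \<Longrightarrow> f x \<in> W" and "z \<in> module.span s1 S"
  shows "f z \<in> W"
proof -
  interpret f: Vector_Spaces.linear s1 s2 f by fact
  have "f.vs1.span S \<subseteq> f -` W"
    using assms(3) by (intro f.vs1.span_minimal f.subspace_vimage assms(2)) auto
  with assms(4) show ?thesis by blast
qed

lemma linear_subspace:
  assumes "Vector_Spaces.linear s1 s2 f"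
  shows subspace_range: "module.subspace s2 (range f)"
    and subspace_preimage: "module.subspace s2 W \<Longrightarrow> module.subspace s1 {x. f x \<in> W}"
proof -
  interpret f: Vector_Spaces.linear s1 s2 f by fact
  show "f.vs2.subspace (range f)" by (rule f.subspace_image) simp
  show "f.vs2.subspace W \<Longrightarrow> f.vs1.subspace {x. f x \<in> W}" by (rule f.subspace_linear_preimage)
qed

lemma linear_extension_from_subspace:
  assumes X: "vector_space sX" and Y: "vector_space sY" and S: "module.subspace sX S"
    and add: "\<And>x y. x \<in> S \<Longrightarrow> y \<in> S \<Longrightarrow> f (x + y) = f x + f y"
    and scale: "\<And>r x. x \<in> S \<Longrightarrow> f (sX r x) = sY r (f x)"
  shows "\<exists>g. Vector_Spaces.linear sX sY g \<and> (\<forall>x\<in>S. g x = f x)"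
proof -
  interpret X: vector_space sX by fact
  interpret Y: vector_space sY by fact
  interpret XY: vector_space_pair sX sY ..
  obtain B where B: "B \<subseteq> S" "X.independent B" "S \<subseteq> X.span B"
    by (meson X.maximal_independent_subset)
  let ?g = "XY.construct B f"
  interpret g: Vector_Spaces.linear sX sY ?g by (rule XY.linear_construct[OF B(2)])
  have f0: "f 0 = 0" using scale[of 0 0] X.subspace_0[OF S] by simp
  have "?g x = f x \<and> x \<in> S" if "x \<in> X.span B" for x
    using that
  proof (induction rule: X.span_induct_alt)
    case base
    then show ?case using f0 X.subspace_0[OF S] by simp
  next
    case (step r x y)
    then have "x \<in> S" using B(1) by blast
    with step show ?case
      using XY.construct_basis[OF B(2) step(1)] S
      by (simp add: g.add g.scale add scale X.subspace_add X.subspace_scale)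
  qed
  with B(3) g.linear_axioms show ?thesis by blast
qed

lemma linear_functional_nonzero:
  assumes "vector_space s" "x \<noteq> 0"
  shows "\<exists>f. Vector_Spaces.linear s (*) f \<and> f x = (1 :: 'k::field)"
proof -
  interpret vector_space s by fact
  have K: "vector_space ((*) :: 'k \<Rightarrow> 'k \<Rightarrow> 'k)" by unfold_locales (auto simp: algebra_simps)
  interpret K: vector_space "(*) :: 'k \<Rightarrow> 'k \<Rightarrow> 'k" by (rule K)
  interpret P: vector_space_pair s "(*) :: 'k \<Rightarrow> 'k \<Rightarrow> 'k" ..
  have "independent {x}" using assms(2) by simp
  then show ?thesis
    using P.linear_construct P.construct_basis[of "{x}" x "\<lambda>_. 1"] by blast
qed

text \<open>
  Inside \<open>S\<close> there is a complement of \<open>W\<close> in \<open>S + W\<close>; the projection onto it along \<open>W\<close> changes the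
  elements of \<open>S\<close> only by elements of \<open>S \<inter> W\<close>.
\<close>

lemma projection_along_subspace:
  assumes X: "vector_space sX" and W: "module.subspace sX W" and S: "module.subspace sX S"
  shows "\<exists>f. Vector_Spaces.linear sX sX f \<and> (\<forall>x\<in>W. f x = 0) \<and> (\<forall>x\<in>S. f x - x \<in> S \<inter> W)"
proof -
  interpret X: vector_space sX by fact
  interpret XX: vector_space_pair sX sX ..
  obtain BW where BW: "BW \<subseteq> W" "X.independent BW" "W \<subseteq> X.span BW"
    by (meson X.maximal_independent_subset)
  obtain B where B: "BW \<subseteq> B" "B \<subseteq> BW \<union> S" "X.independent B" "BW \<union> S \<subseteq> X.span B"
    using X.maximal_independent_subset_extend[of BW "BW \<union> S"] BW(2) by blast
  let ?f = "XX.construct B (\<lambda>x. if x \<in> BW then 0 else x)"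
  interpret f: Vector_Spaces.linear sX sX ?f by (rule XX.linear_construct[OF B(3)])
  have basis: "?f x = (if x \<in> BW then 0 else x)" if "x \<in> B" for x
    using XX.construct_basis[OF B(3) that] by simp
  have "?f x = 0" if "x \<in> X.span BW" for x
    using _ that by (rule f.eq_0_on_span) (use basis B(1) in auto)
  moreover have "?f x \<in> S \<and> ?f x - x \<in> W" if "x \<in> X.span B" for x
    using that
  proof (induction rule: X.span_induct_alt)
    case base
    then show ?case by (simp add: X.subspace_0 W S)
  next
    case (step r x y)
    have x: "?f x \<in> S" "?f x - x \<in> W"
      using basis[OF step(1)] step(1) B(2) BW(1) W S
      by (auto simp: X.subspace_0 X.subspace_neg)
    have "?f (sX r x + y) - (sX r x + y) = sX r (?f x - x) + (?f y - y)"
      by (simp add: f.add f.scale X.scale_right_diff_distrib)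
    then have "?f (sX r x + y) - (sX r x + y) \<in> W"
      using x(2) step(2) by (simp only:) (intro X.subspace_add X.subspace_scale W, auto)
    moreover have "?f (sX r x + y) \<in> S"
      using x(1) step(2) by (simp add: f.add f.scale X.subspace_add X.subspace_scale S)
    ultimately show ?case by blast
  qed
  ultimately show ?thesis
    using f.linear_axioms BW(3) B(4) X.subspace_diff[OF S]
    by (intro exI[of _ ?f]) blast
qed

section \<open>Tensor products\<close>

definition bilinear_map ::
    "('k::field \<Rightarrow> 'a::ab_group_add \<Rightarrow> 'a) \<Rightarrow> ('k \<Rightarrow> 'b::ab_group_add \<Rightarrow> 'b) \<Rightarrow>
     ('k \<Rightarrow> 'y::ab_group_add \<Rightarrow> 'y) \<Rightarrow> ('a \<Rightarrow> 'b \<Rightarrow> 'y) \<Rightarrow> bool"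
  where "bilinear_map sA sB sY \<beta> \<longleftrightarrow>
    (\<forall>y. Vector_Spaces.linear sA sY (\<lambda>x. \<beta> x y)) \<and> (\<forall>x. Vector_Spaces.linear sB sY (\<beta> x))"

context
  fixes sA :: "'k::field \<Rightarrow> 'a::ab_group_add \<Rightarrow> 'a" and sB :: "'k \<Rightarrow> 'b::ab_group_add \<Rightarrow> 'b"
    and sX :: "'k \<Rightarrow> 'x::ab_group_add \<Rightarrow> 'x" and \<tau> :: "'a \<Rightarrow> 'b \<Rightarrow> 'x"
  assumes tp: "tensor_product sA sB sX \<tau>"
begin

lemma tensor_product_spaces: "vector_space sA" "vector_space sB" "vector_space sX"
  using tp unfolding tensor_product_def by blast+

lemma tensor_product_bilinear: "bilinear_map sA sB sX \<tau>"
proof -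
  interpret A: vector_space sA by (rule tensor_product_spaces)
  interpret B: vector_space sB by (rule tensor_product_spaces)
  interpret X: vector_space sX by (rule tensor_product_spaces)
  interpret F: vector_space "free_scale :: 'k \<Rightarrow> ('a \<times> 'b \<Rightarrow>\<^sub>0 'k) \<Rightarrow> _" by (rule vector_space_free_scale)
  let ?e = "free_extend sX (case_prod \<tau>)"
  interpret e: Vector_Spaces.linear free_scale sX ?e
    by (rule linear_free_extend) (rule tensor_product_spaces)
  have zero: "?e p = 0" if "p \<in> bilinear_relations sA sB" for p
    using tp F.span_base[OF that] unfolding tensor_product_def by blast
  have pt [simp]: "?e (pt (x, y)) = \<tau> x y" for x y
    by (simp add: free_extend_pt X.vector_space_axioms)
  have add1: "\<tau> (x + x') y = \<tau> x y + \<tau> x' y" for x x' y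
  proof -
    have "pt (x + x', y) - pt (x, y) - pt (x', y) \<in> bilinear_relations sA sB"
      unfolding bilinear_relations_def by blast
    from zero[OF this] show ?thesis by (simp add: e.diff e.add diff_diff_eq)
  qed
  have add2: "\<tau> x (y + y') = \<tau> x y + \<tau> x y'" for x y y'
  proof -
    have "pt (x, y + y') - pt (x, y) - pt (x, y') \<in> bilinear_relations sA sB"
      unfolding bilinear_relations_def by blast
    from zero[OF this] show ?thesis by (simp add: e.diff e.add diff_diff_eq)
  qed
  have scale1: "\<tau> (sA r x) y = sX r (\<tau> x y)" for r x y
  proof -
    have "pt (sA r x, y) - free_scale r (pt (x, y)) \<in> bilinear_relations sA sB"
      unfolding bilinear_relations_def by blast
    from zero[OF this] show ?thesis by (simp add: e.diff e.scale)
  qed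
  have scale2: "\<tau> x (sB r y) = sX r (\<tau> x y)" for r x y
  proof -
    have "pt (x, sB r y) - free_scale r (pt (x, y)) \<in> bilinear_relations sA sB"
      unfolding bilinear_relations_def by blast
    from zero[OF this] show ?thesis by (simp add: e.diff e.scale)
  qed
  show ?thesis
    unfolding bilinear_map_def Vector_Spaces.linear_iff
    using add1 add2 scale1 scale2 tensor_product_spaces by blast
qed

lemma tensor_induct [case_names tensor add]:
  assumes pure: "\<And>x y. P (\<tau> x y)" and add: "\<And>z z'. P z \<Longrightarrow> P z' \<Longrightarrow> P (z + z')"
  shows "P z"
proof -
  interpret X: vector_space sX by (rule tensor_product_spaces)
  have bil: "\<tau> 0 0 = 0" "sX r (\<tau> x y) = \<tau> (sA r x) y" for r x y
    using tensor_product_bilinear unfolding bilinear_map_def Vector_Spaces.linear_iff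
    by (metis add_cancel_right_left, metis)
  have "z \<in> range (free_extend sX (case_prod \<tau>))"
    using tp unfolding tensor_product_def by blast
  then have "z \<in> X.span (range (case_prod \<tau>))"
    using free_extend_image[OF X.vector_space_axioms] by blast
  then show ?thesis
  proof (induction rule: X.span_induct_alt)
    case base
    then show ?case using pure[of 0 0] by (simp add: bil)
  next
    case (step r x y)
    then show ?case using pure bil by (auto intro!: add)
  qed
qed

lemma tensor_lift_exists:
  assumes Y: "vector_space sY" and \<beta>: "bilinear_map sA sB sY \<beta>"
  shows "\<exists>h. Vector_Spaces.linear sX sY h \<and> (\<forall>x y. h (\<tau> x y) = \<beta> x y)"
proof -
  interpret e: Vector_Spaces.linear free_scale sY "free_extend sY (case_prod \<beta>)"
    by (rule linear_free_extend[OF Y])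
  have bil: "\<beta> (x + x') y = \<beta> x y + \<beta> x' y" "\<beta> x (y + y') = \<beta> x y + \<beta> x y'"
    "\<beta> (sA r x) y = sY r (\<beta> x y)" "\<beta> x (sB r y) = sY r (\<beta> x y)" for x x' y y' r
    using \<beta> unfolding bilinear_map_def Vector_Spaces.linear_iff by blast+
  have "\<exists>h. Vector_Spaces.linear sX sY h \<and> (\<forall>p. h (case_prod \<tau> p) = case_prod \<beta> p)"
  proof (rule linear_map_of_presentation)
    show "surj (free_extend sX (case_prod \<tau>))"
      "{p. free_extend sX (case_prod \<tau>) p = 0} = module.span free_scale (bilinear_relations sA sB)"
      using tp unfolding tensor_product_def by blast+
    show "free_extend sY (case_prod \<beta>) p = 0" if "p \<in> bilinear_relations sA sB" for p
      using that unfolding bilinear_relations_def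
      by (auto simp: e.diff e.scale free_extend_pt[OF Y] bil)
  qed (use Y tensor_product_spaces in auto)
  then show ?thesis by auto
qed

lemma tensor_lift:
  assumes "vector_space sY" and "bilinear_map sA sB sY \<beta>"
  shows linear_tensor_lift: "Vector_Spaces.linear sX sY (tensor_lift sX \<tau> sY \<beta>)"
    and tensor_lift_apply: "tensor_lift sX \<tau> sY \<beta> (\<tau> x y) = \<beta> x y"
proof -
  have "\<exists>h. Vector_Spaces.linear sX sY h \<and> (\<forall>x\<in>UNIV. \<forall>y\<in>UNIV. h (\<tau> x y) = \<beta> x y)"
    using tensor_lift_exists[OF assms] by simp
  from someI_ex[OF this] show "Vector_Spaces.linear sX sY (tensor_lift sX \<tau> sY \<beta>)"
    "tensor_lift sX \<tau> sY \<beta> (\<tau> x y) = \<beta> x y"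
    unfolding tensor_lift_on_def by blast+
qed

text \<open>
  On subspaces it is enough that the prescribed map agree there with one that is bilinear on the
  whole space.
\<close>

lemma tensor_lift_on_apply:
  assumes Y: "vector_space sY" and \<beta>: "bilinear_map sA sB sY \<beta>'"
    and eq: "\<And>x y. x \<in> S \<Longrightarrow> y \<in> S' \<Longrightarrow> \<beta>' x y = \<beta> x y"
  shows "Vector_Spaces.linear sX sY (tensor_lift_on S S' sX \<tau> sY \<beta>)"
    and "x \<in> S \<Longrightarrow> y \<in> S' \<Longrightarrow> tensor_lift_on S S' sX \<tau> sY \<beta> (\<tau> x y) = \<beta> x y"
proof -
  have "\<exists>h. Vector_Spaces.linear sX sY h \<and> (\<forall>x\<in>S. \<forall>y\<in>S'. h (\<tau> x y) = \<beta> x y)"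
    using tensor_lift_exists[OF Y \<beta>] eq by metis
  from someI_ex[OF this] show "Vector_Spaces.linear sX sY (tensor_lift_on S S' sX \<tau> sY \<beta>)"
    "x \<in> S \<Longrightarrow> y \<in> S' \<Longrightarrow> tensor_lift_on S S' sX \<tau> sY \<beta> (\<tau> x y) = \<beta> x y"
    unfolding tensor_lift_on_def by blast+
qed

end

lemma bilinear_map_rules:
  assumes "bilinear_map sA sB sY \<beta>"
  shows "\<beta> (x + x') y = \<beta> x y + \<beta> x' y" "\<beta> x (y + y') = \<beta> x y + \<beta> x y'"
    "\<beta> (sA r x) y = sY r (\<beta> x y)" "\<beta> x (sB r y) = sY r (\<beta> x y)"
    "\<beta> 0 y = 0" "\<beta> x 0 = 0"
    "\<beta> (x - x') y = \<beta> x y - \<beta> x' y" "\<beta> x (y - y') = \<beta> x y - \<beta> x y'"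
    "\<beta> (- x) y = - \<beta> x y" "\<beta> x (- y) = - \<beta> x y"
  using assms linear_rules[of sA sY "\<lambda>x. \<beta> x y"] linear_rules[of sB sY "\<beta> x"]
  unfolding bilinear_map_def by metis+

lemma bilinear_map_linear:
  assumes "bilinear_map sA sB sY \<beta>"
  shows "Vector_Spaces.linear sA sY (\<lambda>x. \<beta> x y)" "Vector_Spaces.linear sB sY (\<beta> x)"
  using assms unfolding bilinear_map_def by blast+

lemma bilinear_map_comp:
  assumes "bilinear_map sC sD sY \<beta>" "Vector_Spaces.linear sA sC f" "Vector_Spaces.linear sB sD g"
  shows "bilinear_map sA sB sY (\<lambda>x y. \<beta> (f x) (g y))"
  using assms linear_comp[of sA sC f sY "\<lambda>x. \<beta> x _"] linear_comp[of sB sD g sY "\<beta> _"]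
  unfolding bilinear_map_def by blast

lemma linear_bilinear_comp:
  assumes "bilinear_map sA sB sY \<beta>" "Vector_Spaces.linear sY sZ h"
  shows "bilinear_map sA sB sZ (\<lambda>x y. h (\<beta> x y))"
  using assms linear_comp[of sA sY "\<lambda>x. \<beta> x _" sZ h] linear_comp[of sB sY "\<beta> _" sZ h]
  unfolding bilinear_map_def by blast

lemma tensor_map:
  assumes X: "tensor_product sA sB sX \<tau>" and Y: "tensor_product sC sD sY \<tau>'"
    and f: "Vector_Spaces.linear sA sC f" and g: "Vector_Spaces.linear sB sD g"
  shows linear_tensor_map: "Vector_Spaces.linear sX sY (tensor_map sX \<tau> sY \<tau>' f g)"
    and tensor_map_apply: "tensor_map sX \<tau> sY \<tau>' f g (\<tau> x y) = \<tau>' (f x) (g y)"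
proof -
  have "bilinear_map sA sB sY (\<lambda>x y. \<tau>' (f x) (g y))"
    by (rule bilinear_map_comp[OF tensor_product_bilinear[OF Y] f g])
  note tensor_lift[OF X tensor_product_spaces(3)[OF Y] this]
  then show "Vector_Spaces.linear sX sY (tensor_map sX \<tau> sY \<tau>' f g)"
    "tensor_map sX \<tau> sY \<tau>' f g (\<tau> x y) = \<tau>' (f x) (g y)" by blast+
qed

lemma tensor_linear_eq:
  assumes X: "tensor_product sA sB sX \<tau>"
    and f: "Vector_Spaces.linear sX sY f" and g: "Vector_Spaces.linear sX sY g"
    and eq: "\<And>x y. f (\<tau> x y) = g (\<tau> x y)"
  shows "f z = g z"
  by (induction z rule: tensor_induct[OF X]) (simp_all add: eq linear_rules(1)[OF f] linear_rules(1)[OF g])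

text \<open>
  A functional \<open>f\<close> with \<open>f x = 1\<close> induces the map \<open>f \<otimes> B\<close> to \<open>B\<close>, which recovers \<open>y\<close> from \<open>x \<otimes> y\<close>.
\<close>

lemma nonzero_tensor_eq_zero:
  assumes X: "tensor_product sA sB sX \<tau>" and "x \<noteq> 0" "\<tau> x y = 0"
  shows "y = 0"
proof -
  note sp = tensor_product_spaces[OF X]
  interpret B: vector_space sB by (rule sp)
  obtain f where f: "Vector_Spaces.linear sA (*) f" "f x = 1"
    using linear_functional_nonzero[OF sp(1) assms(2)] by blast
  have "bilinear_map sA sB sB (\<lambda>x y. sB (f x) y)"
    unfolding bilinear_map_def Vector_Spaces.linear_iff using sp
    by (simp add: linear_rules[OF f(1)] B.scale_left_distrib B.scale_right_distrib mult.commute)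
  from tensor_lift[OF X sp(2) this] assms(3) f(2) show ?thesis
    using linear_rules(3) by (metis B.scale_one)
qed

context tensor_cube
begin

lemma cube_spaces:
  "vector_space (sc A)" "vector_space (sc2 A)" "vector_space (sc3 A)"
  using tensor_product_spaces[OF tensor_21] tensor_11 tensor_product_spaces by blast+

lemma act12:
  assumes "Vector_Spaces.linear (sc2 A) (sc2 A) f"
  shows linear_act12: "Vector_Spaces.linear (sc3 A) (sc3 A) (act12 A f)"
    and act12_apply: "act12 A f (tens21 A z x) = tens21 A (f z) x"
  unfolding act12_def
  using tensor_map[OF tensor_21 tensor_21 assms linear_identity(1)[OF cube_spaces(1)]] by auto

lemma act23:
  assumes "Vector_Spaces.linear (sc2 A) (sc2 A) f"
  shows linear_act23: "Vector_Spaces.linear (sc3 A) (sc3 A) (act23 A f)"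
    and act23_apply: "act23 A f (tens12 A x z) = tens12 A x (f z)"
  unfolding act23_def
  using tensor_map[OF tensor_12 tensor_12 linear_identity(1)[OF cube_spaces(1)] assms] by auto

lemma mult_left:
  assumes "Vector_Spaces.linear (sc2 A) (sc A) m"
  shows linear_mult_left: "Vector_Spaces.linear (sc3 A) (sc2 A) (mult_left A m)"
    and mult_left_apply: "mult_left A m (tens21 A z x) = tens A (m z) x"
  unfolding mult_left_def
  using tensor_map[OF tensor_21 tensor_11 assms linear_identity(1)[OF cube_spaces(1)]] by auto

lemma mult_right:
  assumes "Vector_Spaces.linear (sc2 A) (sc A) m"
  shows linear_mult_right: "Vector_Spaces.linear (sc3 A) (sc2 A) (mult_right A m)"
    and mult_right_apply: "mult_right A m (tens12 A x z) = tens A x (m z)"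
  unfolding mult_right_def
  using tensor_map[OF tensor_12 tensor_11 linear_identity(1)[OF cube_spaces(1)] assms] by auto

end

section \<open>Two-sided ideals\<close>

lemma two_sided_ideal_hull: "two_sided_ideal (two_sided_ideal hull S)"
  unfolding hull_def two_sided_ideal_def by blast

lemma two_sided_ideal_diff:
  assumes "two_sided_ideal I" "x \<in> I" "y \<in> I"
  shows "x - y \<in> I"
proof -
  have "- 1 * y \<in> I" using assms unfolding two_sided_ideal_def by blast
  then show ?thesis using assms unfolding two_sided_ideal_def by force
qed

lemma ideal_coset_eq:
  assumes "two_sided_ideal I" "x - y \<in> I"
  shows "ideal_coset I x = ideal_coset I y"
proof -
  have neg: "y - x \<in> I"
    using two_sided_ideal_diff[OF assms(1), of 0 "x - y"] assms unfolding two_sided_ideal_def by simp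
  have add: "i + k \<in> I" if "i \<in> I" "k \<in> I" for i k
    using assms(1) that unfolding two_sided_ideal_def by blast
  show ?thesis
  proof (intro subset_antisym subsetI)
    fix a assume "a \<in> ideal_coset I x"
    then obtain i where "i \<in> I" "a = x + i" unfolding ideal_coset_def by blast
    then have "a = y + ((x - y) + i)" "(x - y) + i \<in> I" using add[OF assms(2)] by simp_all
    then show "a \<in> ideal_coset I y" unfolding ideal_coset_def by blast
  next
    fix a assume "a \<in> ideal_coset I y"
    then obtain i where "i \<in> I" "a = y + i" unfolding ideal_coset_def by blast
    then have "a = x + ((y - x) + i)" "(y - x) + i \<in> I" using add[OF neg] by simp_all
    then show "a \<in> ideal_coset I x" unfolding ideal_coset_def by blast
  qed
qed

section \<open>The product of the braided tensor square\<close>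

context braided_tensor_algebra
begin

sublocale VS: vector_space "sc V" by (rule space_V)
sublocale V2S: vector_space "sc2 V" by (rule V.cube_spaces)
sublocale TS: vector_space "sc T" by (rule space_T)
sublocale T2S: vector_space "sc2 T" by (rule T.cube_spaces)

abbreviation tensT (infixl "\<otimes>" 69) where "x \<otimes> y \<equiv> tens T x y"
abbreviation mulT where "mulT \<equiv> tensor_lift (sc2 T) (tens T) (sc T) (*)"
abbreviation tmap where "tmap f g \<equiv> tensor_map (sc2 T) (tens T) (sc2 T) (tens T) f g"

lemmas tens_bilinear = tensor_product_bilinear[OF T.tensor_11]
lemmas tens_rules = bilinear_map_rules[OF tens_bilinear]
lemmas tmap = tensor_map[OF T.tensor_11 T.tensor_11]
lemmas cT_rules = linear_rules[OF T.linear_braiding]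
lemmas Delta_rules = linear_rules[OF T.linear_\<Delta>]

lemma bilinear_times: "bilinear_map (sc T) (sc T) (sc T) (*)"
  unfolding bilinear_map_def Vector_Spaces.linear_iff
  by (simp add: algebra_simps TS.vector_space_axioms scale_mult_left[symmetric] scale_mult_right[symmetric])

lemmas times_linear = bilinear_map_linear[OF bilinear_times]

lemma linear_times_right: "Vector_Spaces.linear (sc T) (sc T) (\<lambda>x. x * a)"
  by (rule times_linear)

lemma mulT: "mulT (x \<otimes> y) = x * y"
  by (rule tensor_lift_apply[OF T.tensor_11 TS.vector_space_axioms bilinear_times])

lemmas mulT_linear = T.linear_m

definition lmult :: "'t \<Rightarrow> 't2 \<Rightarrow> 't2"
  where "lmult a = tmap ((*) a) id"

definition rmult :: "'t \<Rightarrow> 't2 \<Rightarrow> 't2"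
  where "rmult b = tmap id (\<lambda>x. x * b)"

lemma lmult: "Vector_Spaces.linear (sc2 T) (sc2 T) (lmult a)" "lmult a (x \<otimes> y) = a * x \<otimes> y"
  unfolding lmult_def using tmap[OF times_linear(2) linear_identity(1)[OF TS.vector_space_axioms]] by auto

lemma rmult: "Vector_Spaces.linear (sc2 T) (sc2 T) (rmult b)" "rmult b (x \<otimes> y) = x \<otimes> y * b"
  unfolding rmult_def using tmap[OF linear_identity(1)[OF TS.vector_space_axioms] linear_times_right] by auto

text \<open>
  The two halves of the compatibility of the braiding with the product: to move the product \<open>x y\<close>
  past \<open>z\<close>, first move \<open>y\<close> past \<open>z\<close> and then apply \<open>hexl x\<close>, which moves \<open>x\<close> past the left tensor factor
  and multiplies it into the right one.  The map \<open>hexr z\<close> is its mirror image.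
\<close>

definition hexl :: "'t \<Rightarrow> 't2 \<Rightarrow> 't2"
  where "hexl x Z = mult_right T mulT (act12 T cT (tens12 T x Z))"

definition hexr :: "'t \<Rightarrow> 't2 \<Rightarrow> 't2"
  where "hexr z Z = mult_left T mulT (act23 T cT (tens21 T Z z))"

lemma linear_hexl: "Vector_Spaces.linear (sc2 T) (sc2 T) (hexl x)"
  unfolding hexl_def
  by (rule linear_comp[OF linear_comp[OF bilinear_map_linear(2)[OF tensor_product_bilinear[OF T.tensor_12]]
          T.linear_act12[OF T.linear_braiding]] T.linear_mult_right[OF mulT_linear]])

lemma linear_hexr: "Vector_Spaces.linear (sc2 T) (sc2 T) (hexr x)"
  unfolding hexr_def
  by (rule linear_comp[OF linear_comp[OF bilinear_map_linear(1)[OF tensor_product_bilinear[OF T.tensor_21]]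
          T.linear_act23[OF T.linear_braiding]] T.linear_mult_left[OF mulT_linear]])

lemma hexl_tens: "hexl x (y \<otimes> z) = rmult z (cT (x \<otimes> y))"
proof -
  have *: "mult_right T mulT (tens21 T Z z) = rmult z Z" for Z
    by (rule tensor_linear_eq[OF T.tensor_11 linear_comp[OF
            bilinear_map_linear(1)[OF tensor_product_bilinear[OF T.tensor_21]]
            T.linear_mult_right[OF mulT_linear]] rmult(1)])
      (simp add: T.tens_assoc T.mult_right_apply[OF mulT_linear] mulT rmult)
  show ?thesis
    unfolding hexl_def by (simp add: T.tens_assoc[symmetric] T.act12_apply[OF T.linear_braiding] *)
qed

lemma hexr_tens: "hexr z (x \<otimes> y) = lmult x (cT (y \<otimes> z))"
proof -
  have *: "mult_left T mulT (tens12 T x Z) = lmult x Z" for Z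
    by (rule tensor_linear_eq[OF T.tensor_11 linear_comp[OF
            bilinear_map_linear(2)[OF tensor_product_bilinear[OF T.tensor_12]]
            T.linear_mult_left[OF mulT_linear]] lmult(1)])
      (simp add: T.tens_assoc[symmetric] T.mult_left_apply[OF mulT_linear] mulT lmult)
  show ?thesis
    unfolding hexr_def by (simp add: T.tens_assoc T.act23_apply[OF T.linear_braiding] *)
qed

lemma cT_mult_left: "cT (x * y \<otimes> z) = hexl x (cT (y \<otimes> z))"
proof -
  have "cT (x * y \<otimes> z) = (cT \<circ> mult_left T mulT) (tens21 T (x \<otimes> y) z)"
    by (simp add: T.mult_left_apply[OF mulT_linear] mulT)
  also have "\<dots> = hexl x (cT (y \<otimes> z))"
    unfolding T.c_mult_left by (simp add: hexl_def T.tens_assoc T.act23_apply[OF T.linear_braiding])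
  finally show ?thesis .
qed

lemma cT_mult_right: "cT (x \<otimes> y * z) = hexr z (cT (x \<otimes> y))"
proof -
  have "cT (x \<otimes> y * z) = (cT \<circ> mult_right T mulT) (tens12 T x (y \<otimes> z))"
    by (simp add: T.mult_right_apply[OF mulT_linear] mulT)
  also have "\<dots> = hexr z (cT (x \<otimes> y))"
    unfolding T.c_mult_right
    by (simp add: hexr_def T.tens_assoc[symmetric] T.act12_apply[OF T.linear_braiding])
  finally show ?thesis .
qed

lemma cT_unit: "cT (1 \<otimes> x) = x \<otimes> 1" "cT (x \<otimes> 1) = 1 \<otimes> x"
  using T.c_unit_left[of 1 x] T.c_unit_right[of x 1] by simp_all

text \<open>
  The product of the braided tensor square \<open>T \<otimes> T\<close>, for which \<open>\<Delta>\<close> is an algebra map.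
\<close>

definition bmul :: "'t2 \<Rightarrow> 't2 \<Rightarrow> 't2"
  where "bmul Z Z' = tensor_map (sc4 T) (tens22 T) (sc2 T) (tens T) mulT mulT
    (tensor_map (sc4 T) (tens13 T) (sc4 T) (tens13 T) id (act12 T cT) (tens22 T Z Z'))"

lemmas quad_maps = tensor_map[OF T.tensor_22 T.tensor_11 mulT_linear mulT_linear]
  tensor_map[OF T.tensor_13 T.tensor_13 linear_identity(2)[OF TS.vector_space_axioms] T.linear_act12[OF T.linear_braiding]]

lemma bmul_bilinear: "bilinear_map (sc2 T) (sc2 T) (sc2 T) bmul"
  unfolding bmul_def id_apply
  by (rule linear_bilinear_comp[OF linear_bilinear_comp[OF tensor_product_bilinear[OF T.tensor_22]
          quad_maps(3)] quad_maps(1)])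

lemmas bmul_rules = bilinear_map_rules[OF bmul_bilinear]

text \<open>
  Both sides are linear in the element \<open>cT (b \<otimes> a')\<close> in the middle, so it may be replaced by a pure
  tensor, on which the identity is the definition.
\<close>

lemma bmul_tens: "bmul (a \<otimes> b) (a' \<otimes> b') = lmult a (rmult b' (cT (b \<otimes> a')))"
proof -
  let ?mm = "tensor_map (sc4 T) (tens22 T) (sc2 T) (tens T) mulT mulT"
  have *: "?mm (tens13 T a (tens21 T Z b')) = lmult a (rmult b' Z)" for Z
    by (rule tensor_linear_eq[OF T.tensor_11
          linear_comp[OF linear_comp[OF bilinear_map_linear(1)[OF tensor_product_bilinear[OF T.tensor_21]]
             bilinear_map_linear(2)[OF tensor_product_bilinear[OF T.tensor_13]]] quad_maps(1)]
          linear_comp[OF rmult(1) lmult(1)]])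
      (simp add: T.tens_assoc T.tens_assoc4[symmetric] quad_maps mulT rmult lmult)
  show ?thesis
    unfolding bmul_def id_apply
    by (simp add: T.tens_assoc4 T.tens_assoc[symmetric] quad_maps T.act12_apply[OF T.linear_braiding] *)
qed

lemma Delta_mult: "\<Delta> (x * y) = bmul (\<Delta> x) (\<Delta> y)"
proof -
  have "\<Delta> (x * y) = (\<Delta> \<circ> mulT) (x \<otimes> y)" by (simp add: mulT)
  also have "\<dots> = bmul (\<Delta> x) (\<Delta> y)"
    unfolding T.\<Delta>_m
    by (simp add: bmul_def tensor_map[OF T.tensor_11 T.tensor_22 T.linear_\<Delta> T.linear_\<Delta>])
  finally show ?thesis .
qed

lemma Delta_one: "\<Delta> 1 = 1 \<otimes> 1"
  using T.\<Delta>_unit by simp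

lemma epsilon_simps: "\<epsilon> (x * y) = \<epsilon> x * \<epsilon> y" "\<epsilon> 1 = 1"
  using T.\<epsilon>_m[of x y] T.\<epsilon>_unit by (simp_all add: mulT)

section \<open>Degrees, and the primitive elements of the tensor algebra\<close>

lemma free_words_relation:
  assumes "p \<in> multilinear_relations (sc V)"
  shows "free_extend (sc T) (\<lambda>vs. prod_list (map \<iota> vs)) p = 0"
proof -
  interpret F: vector_space "free_scale :: 'k \<Rightarrow> ('v list \<Rightarrow>\<^sub>0 'k) \<Rightarrow> _" by (rule vector_space_free_scale)
  show ?thesis using words_kernel F.span_base[OF assms] by blast
qed

lemma linear_iota: "Vector_Spaces.linear (sc V) (sc T) \<iota>"
proof -
  interpret e: Vector_Spaces.linear free_scale "sc T" "free_extend (sc T) (\<lambda>vs. prod_list (map \<iota> vs))"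
    by (rule linear_free_extend) (rule space_T)
  have "\<iota> (v + w) = \<iota> v + \<iota> w" for v w
  proof -
    have "pt ([] @ (v + w) # []) - pt ([] @ v # []) - pt ([] @ w # []) \<in> multilinear_relations (sc V)"
      unfolding multilinear_relations_def by blast
    from free_words_relation[OF this] show ?thesis
      by (simp add: e.diff e.add free_extend_pt space_T diff_diff_eq)
  qed
  moreover have "\<iota> (sc V r v) = sc T r (\<iota> v)" for r v
  proof -
    have "pt ([] @ sc V r v # []) - free_scale r (pt ([] @ v # [])) \<in> multilinear_relations (sc V)"
      unfolding multilinear_relations_def by blast
    from free_words_relation[OF this] show ?thesis
      by (simp add: e.diff e.scale free_extend_pt space_T)
  qed
  ultimately show ?thesis
    unfolding Vector_Spaces.linear_iff using space_V space_T by blast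
qed

lemmas iota_rules = linear_rules[OF linear_iota]

lemma span_words: "x \<in> TS.span (range (\<lambda>vs. prod_list (map \<iota> vs)))"
  using words_surj free_extend_image[OF space_T] by (metis surjD)

text \<open>Induction over \<open>T\<close> as the algebra generated by \<open>V\<close>.\<close>

lemma generated_by_V [case_names one iota mult add scale]:
  assumes one: "P 1" and iota: "\<And>v. P (\<iota> v)"
    and mult: "\<And>x y. P x \<Longrightarrow> P y \<Longrightarrow> P (x * y)"
    and add: "\<And>x y. P x \<Longrightarrow> P y \<Longrightarrow> P (x + y)"
    and scale: "\<And>r x. P x \<Longrightarrow> P (sc T r x)"
  shows "P x"
  using span_words
proof (induction rule: TS.span_induct_alt)
  case base
  then show ?case using scale[OF one, of 0] by simp
next
  case (step r x y)
  then obtain vs where "x = prod_list (map \<iota> vs)" by blast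
  moreover have "P (prod_list (map \<iota> vs))" by (induction vs) (simp_all add: one iota mult)
  ultimately show ?case using step add scale by blast
qed

abbreviation deg :: "nat \<Rightarrow> 't set" where "deg \<equiv> degree_part (sc T) \<iota>"

lemma subspace_deg: "TS.subspace (deg n)"
  unfolding degree_part_def by (rule TS.subspace_span)

lemma word_deg: "prod_list (map \<iota> vs) \<in> deg (length vs)"
  unfolding degree_part_def by (rule TS.span_base) blast

lemma one_deg: "1 \<in> deg 0" and iota_deg: "\<iota> v \<in> deg 1"
  using word_deg[of "[]"] word_deg[of "[v]"] by simp_all

lemma deg_induct [consumes 1, case_names word zero add scale]:
  assumes "x \<in> deg n"
    and word: "\<And>vs. length vs = n \<Longrightarrow> P (prod_list (map \<iota> vs))"
    and "P 0" "\<And>x y. P x \<Longrightarrow> P y \<Longrightarrow> P (x + y)" "\<And>r x. P x \<Longrightarrow> P (sc T r x)"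
  shows "P x"
  using assms(1) unfolding degree_part_def
  by (induction rule: TS.span_induct_alt) (use assms in blast)+

lemma mult_deg:
  assumes "x \<in> deg i" "y \<in> deg j" shows "x * y \<in> deg (i + j)"
proof -
  have "prod_list (map \<iota> vs) * y \<in> deg (length vs + j)" for vs
    by (rule linear_span_into[OF times_linear(2) subspace_deg _ assms(2)[unfolded degree_part_def]])
      (use word_deg[of "vs @ _"] in auto)
  then show ?thesis
    by (intro linear_span_into[OF times_linear(1) subspace_deg _ assms(1)[unfolded degree_part_def]]) auto
qed

lemma iota_mult_deg: "x \<in> deg n \<Longrightarrow> \<iota> v * x \<in> deg (Suc n)"
  using mult_deg[OF iota_deg] by simp

text \<open>
  Deleting the words of length other than \<open>n\<close> respects the multilinearity relations because these
  are homogeneous; as words span \<open>T\<close>, only one linear map does this.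
\<close>

lemma degree_proj:
  shows linear_degree_proj: "Vector_Spaces.linear (sc T) (sc T) (degree_proj (sc T) \<iota> n)"
    and degree_proj_deg: "x \<in> deg i \<Longrightarrow> degree_proj (sc T) \<iota> n x = (if i = n then x else 0)"
proof -
  let ?w = "\<lambda>vs. prod_list (map \<iota> vs)"
  let ?h = "\<lambda>vs. if length vs = n then ?w vs else 0"
  let ?spec = "\<lambda>p. Vector_Spaces.linear (sc T) (sc T) p \<and> (\<forall>vs. p (?w vs) = ?h vs)"
  interpret e: Vector_Spaces.linear free_scale "sc T" "free_extend (sc T) ?h"
    by (rule linear_free_extend) (rule space_T)
  have "\<exists>p. ?spec p"
  proof (rule linear_map_of_presentation[OF space_T space_T words_surj words_kernel])
    show "free_extend (sc T) ?h p = 0" if "p \<in> multilinear_relations (sc V)" for p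
      using that unfolding multilinear_relations_def
      by (auto simp: e.diff e.scale free_extend_pt[OF space_T] iota_rules distrib_left distrib_right
          scale_mult_left[symmetric] scale_mult_right[symmetric])
  qed
  \<comment> \<open>Uniqueness, so that the definite description denotes.\<close>
  moreover have "p = p'" if "?spec p" "?spec p'" for p p'
  proof
    fix x
    have lin: "Vector_Spaces.linear (sc T) (sc T) (\<lambda>x. p x - p' x)"
      using that by (blast intro: linear_plus_minus)
    have "p x - p' x \<in> {0}"
      by (rule linear_span_into[OF lin TS.subspace_single_0 _ span_words]) (use that in auto)
    then show "p x = p' x" by simp
  qed
  ultimately have "\<exists>!p. ?spec p" by (rule ex_ex1I)
  from theI'[OF this] have spec: "?spec (degree_proj (sc T) \<iota> n)"
    unfolding degree_proj_def .
  then show lin: "Vector_Spaces.linear (sc T) (sc T) (degree_proj (sc T) \<iota> n)" by blast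
  show "degree_proj (sc T) \<iota> n x = (if i = n then x else 0)" if "x \<in> deg i"
    using that by (induction rule: deg_induct) (use spec in \<open>auto simp: linear_rules[OF lin]\<close>)
qed

definition tspan :: "'t set \<Rightarrow> 't set \<Rightarrow> 't2 set"
  where "tspan P Q = T2S.span {x \<otimes> y | x y. x \<in> P \<and> y \<in> Q}"

lemma subspace_tspan: "T2S.subspace (tspan P Q)"
  unfolding tspan_def by (rule T2S.subspace_span)

lemma tens_tspan: "x \<in> P \<Longrightarrow> y \<in> Q \<Longrightarrow> x \<otimes> y \<in> tspan P Q"
  unfolding tspan_def by (rule T2S.span_base) blast

lemma tspan_into:
  assumes "Vector_Spaces.linear (sc2 T) s f" "module.subspace s W"
    and "\<And>x y. x \<in> P \<Longrightarrow> y \<in> Q \<Longrightarrow> f (x \<otimes> y) \<in> W" and "Z \<in> tspan P Q"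
  shows "f Z \<in> W"
  by (rule linear_span_into[OF assms(1,2) _ assms(4)[unfolded tspan_def]]) (use assms(3) in blast)

lemma tspan_mono: "P \<subseteq> P' \<Longrightarrow> Q \<subseteq> Q' \<Longrightarrow> tspan P Q \<subseteq> tspan P' Q'"
  unfolding tspan_def by (intro T2S.span_mono) blast

lemma tspan_UNIV: "Z \<in> tspan UNIV UNIV"
  by (induction Z rule: tensor_induct[OF T.tensor_11])
    (auto intro: tens_tspan T2S.subspace_add[OF subspace_tspan])

abbreviation iota2 where "iota2 \<equiv> tensor_map (sc2 V) (tens V) (sc2 T) (tens T) \<iota> \<iota>"

lemmas iota2 = tensor_map[OF V.tensor_11 T.tensor_11 linear_iota linear_iota]

lemma iota2_tspan: "iota2 z \<in> tspan (range \<iota>) (range \<iota>)"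
  by (induction z rule: tensor_induct[OF V.tensor_11])
    (auto simp: iota2 linear_rules[OF iota2(1)] intro: tens_tspan T2S.subspace_add[OF subspace_tspan])

text \<open>
  To move \<open>v\<close> past a word, move it past the first letter, which produces tensors \<open>u' \<otimes> v'\<close>, and then move
  each \<open>v'\<close> past the rest of the word.
\<close>

lemma cT_iota_deg:
  assumes "x \<in> deg n"
  shows "cT (\<iota> v \<otimes> x) \<in> tspan (deg n) (range \<iota>)"
proof -
  have "cT (\<iota> v \<otimes> prod_list (map \<iota> vs)) \<in> tspan (deg (length vs)) (range \<iota>)" for vs
  proof (induction vs arbitrary: v)
    case Nil
    then show ?case by (simp add: cT_unit one_deg tens_tspan)
  next
    case (Cons u us)
    let ?w = "prod_list (map \<iota> us)"
    have "hexr ?w (iota2 (c (tens V v u))) \<in> tspan (deg (Suc (length us))) (range \<iota>)"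
    proof (rule tspan_into[OF linear_hexr subspace_tspan _ iota2_tspan])
      fix x y assume "x \<in> range \<iota>" "y \<in> range \<iota>"
      then obtain u' v' where [simp]: "x = \<iota> u'" "y = \<iota> v'" by blast
      show "hexr ?w (x \<otimes> y) \<in> tspan (deg (Suc (length us))) (range \<iota>)"
        unfolding hexr_tens
        by (rule tspan_into[OF lmult(1) subspace_tspan _ Cons[of v', folded \<open>y = \<iota> v'\<close>]])
          (use mult_deg[OF iota_deg[of u']] in \<open>auto simp: lmult intro!: tens_tspan\<close>)
    qed
    then show ?case by (simp add: cT_mult_right cT_extends)
  qed
  then have "cT (\<iota> v \<otimes> w) \<in> tspan (deg n) (range \<iota>)"
    if "w \<in> {prod_list (map \<iota> vs) | vs. length vs = n}" for w
    using that by blast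
  then show ?thesis
    by (rule linear_span_into[OF linear_comp[OF bilinear_map_linear(2)[OF tens_bilinear] T.linear_braiding]
          subspace_tspan _ assms[unfolded degree_part_def]])
qed

lemma bmul_one:
  "bmul (a \<otimes> 1) Z = lmult a Z" "bmul (1 \<otimes> a) (x \<otimes> y) = rmult y (cT (a \<otimes> x))"
proof -
  have *: "lmult 1 Z' = Z'" for Z'
    by (rule tensor_linear_eq[OF T.tensor_11 lmult(1) linear_identity(2)[OF T2S.vector_space_axioms]])
      (simp add: lmult)
  show "bmul (a \<otimes> 1) Z = lmult a Z"
    by (rule tensor_linear_eq[OF T.tensor_11 bilinear_map_linear(2)[OF bmul_bilinear] lmult(1)])
      (simp add: bmul_tens cT_unit rmult lmult)
  show "bmul (1 \<otimes> a) (x \<otimes> y) = rmult y (cT (a \<otimes> x))"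
    by (simp add: bmul_tens *)
qed

lemma rmult_one: "rmult 1 Z = Z"
  by (rule tensor_linear_eq[OF T.tensor_11 rmult(1) linear_identity(2)[OF T2S.vector_space_axioms]])
    (simp add: rmult)

text \<open>
  All statements about \<open>\<Delta>\<close> on words are proved by adding one letter on the left with this formula.
\<close>

lemma Delta_iota_mult: "\<Delta> (\<iota> v * x) = lmult (\<iota> v) (\<Delta> x) + bmul (1 \<otimes> \<iota> v) (\<Delta> x)"
  by (simp add: Delta_mult primitive bmul_rules bmul_one)

lemma bmul_iota_unit: "bmul (1 \<otimes> \<iota> v) (1 \<otimes> x) = 1 \<otimes> \<iota> v * x" "bmul (1 \<otimes> \<iota> v) (x \<otimes> 1) = cT (\<iota> v \<otimes> x)"
  by (simp_all add: bmul_one cT_unit rmult rmult_one)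

lemma bmul_iota_deg:
  assumes "x \<in> deg i" "y \<in> deg j"
  shows "bmul (1 \<otimes> \<iota> v) (x \<otimes> y) \<in> tspan (deg i) (deg (Suc j))"
  unfolding bmul_one
  by (rule tspan_into[OF rmult(1) subspace_tspan _ cT_iota_deg[OF assms(1)]])
    (use mult_deg[OF iota_deg assms(2)] in \<open>auto simp: rmult assms intro!: tens_tspan\<close>)

text \<open>
  The sum of the \<open>T\<^sup>a \<otimes> T\<^sup>b\<close> with \<open>a + b = n\<close> and both degrees positive.
\<close>

definition mid :: "nat \<Rightarrow> 't2 set"
  where "mid n = T2S.span {x \<otimes> y | x y a b. x \<in> deg a \<and> y \<in> deg b \<and> 1 \<le> a \<and> 1 \<le> b \<and> a + b = n}"

lemma subspace_mid: "T2S.subspace (mid n)"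
  unfolding mid_def by (rule T2S.subspace_span)

lemma tspan_mid: "1 \<le> a \<Longrightarrow> 1 \<le> b \<Longrightarrow> a + b = n \<Longrightarrow> tspan (deg a) (deg b) \<subseteq> mid n"
  unfolding mid_def tspan_def by (intro T2S.span_mono) blast

text \<open>
  Adding a letter \<open>v\<close> to a word \<open>w\<close> creates, besides the two outer terms, the tensors \<open>v \<otimes> w\<close> and
  \<open>cT (v \<otimes> w)\<close>; all other new terms come from inner ones, by raising one of their two degrees.
\<close>

lemma Delta_deg:
  assumes "x \<in> deg n" "n \<ge> 1"
  shows "\<Delta> x - x \<otimes> 1 - 1 \<otimes> x \<in> mid n"
proof -
  have lin: "Vector_Spaces.linear (sc T) (sc2 T) (\<lambda>x. \<Delta> x - x \<otimes> 1 - 1 \<otimes> x)"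
    by (intro linear_plus_minus T.linear_\<Delta> bilinear_map_linear[OF tens_bilinear])
  have words: "\<Delta> w - w \<otimes> 1 - 1 \<otimes> w \<in> mid (length vs)" if "vs \<noteq> []" "w = prod_list (map \<iota> vs)" for vs w
    using that
  proof (induction vs arbitrary: w)
    case (Cons v us)
    define w' where "w' = prod_list (map \<iota> us)"
    have w: "w = \<iota> v * w'" using Cons.prems by (simp add: w'_def)
    show ?case
    proof (cases "us = []")
      case True
      then show ?thesis
        by (simp add: w w'_def primitive T2S.subspace_0[OF subspace_mid])
    next
      case False
      define M where "M = \<Delta> w' - w' \<otimes> 1 - 1 \<otimes> w'"
      have M: "M \<in> mid (length us)" using Cons.IH[OF False] by (simp add: M_def w'_def)
      have Delta: "\<Delta> w' = w' \<otimes> 1 + 1 \<otimes> w' + M" by (simp add: M_def)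
      have "\<Delta> w - w \<otimes> 1 - 1 \<otimes> w
          = \<iota> v \<otimes> w' + lmult (\<iota> v) M + cT (\<iota> v \<otimes> w') + bmul (1 \<otimes> \<iota> v) M"
        by (simp add: w Delta_iota_mult Delta linear_rules[OF lmult(1)] lmult bmul_rules bmul_iota_unit)
      moreover have us: "1 \<le> length us" using False by (cases us) auto
      have "\<iota> v \<otimes> w' \<in> mid (length (v # us))"
        by (rule subsetD[OF tspan_mid[of 1 "length us"]])
          (use us in \<open>auto simp: w'_def intro!: tens_tspan iota_deg[unfolded One_nat_def] word_deg\<close>)
      moreover have "cT (\<iota> v \<otimes> w') \<in> mid (length (v # us))"
        by (rule subsetD[OF tspan_mid[of "length us" 1]])
          (use us cT_iota_deg[OF word_deg, of v us] tspan_mono[of "deg (length us)" "deg (length us)" "range \<iota>" "deg 1"] iota_deg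
           in \<open>auto simp: w'_def\<close>)
      moreover have "lmult (\<iota> v) M \<in> mid (length (v # us))"
      proof (rule linear_span_into[OF lmult(1) subspace_mid _ M[unfolded mid_def]])
        fix Z assume "Z \<in> {x \<otimes> y | x y a b. x \<in> deg a \<and> y \<in> deg b \<and> 1 \<le> a \<and> 1 \<le> b \<and> a + b = length us}"
        then obtain x y a b where *: "Z = x \<otimes> y" "x \<in> deg a" "y \<in> deg b" "1 \<le> a" "1 \<le> b" "a + b = length us"
          by blast
        have "lmult (\<iota> v) Z \<in> tspan (deg (1 + a)) (deg b)"
          using * by (auto simp: lmult intro!: tens_tspan iota_mult_deg)
        then show "lmult (\<iota> v) Z \<in> mid (length (v # us))"
          using tspan_mid[of "1 + a" b "length (v # us)"] * by auto
      qed
      moreover have "bmul (1 \<otimes> \<iota> v) M \<in> mid (length (v # us))"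
      proof (rule linear_span_into[OF bilinear_map_linear(2)[OF bmul_bilinear] subspace_mid _ M[unfolded mid_def]])
        fix Z assume "Z \<in> {x \<otimes> y | x y a b. x \<in> deg a \<and> y \<in> deg b \<and> 1 \<le> a \<and> 1 \<le> b \<and> a + b = length us}"
        then obtain x y a b where *: "Z = x \<otimes> y" "x \<in> deg a" "y \<in> deg b" "1 \<le> a" "1 \<le> b" "a + b = length us"
          by blast
        then show "bmul (1 \<otimes> \<iota> v) Z \<in> mid (length (v # us))"
          using bmul_iota_deg[OF *(2,3)] tspan_mid[of a "Suc b" "length (v # us)"] by auto
      qed
      ultimately show ?thesis by (simp add: T2S.subspace_add[OF subspace_mid])
    qed
  qed simp
  then have "\<Delta> w - w \<otimes> 1 - 1 \<otimes> w \<in> mid n" if "w \<in> {prod_list (map \<iota> vs) | vs. length vs = n}" for w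
  proof -
    from that obtain vs where vs: "w = prod_list (map \<iota> vs)" "length vs = n" by blast
    then have "vs \<noteq> []" using assms(2) by auto
    from words[OF this vs(1)] show ?thesis by (simp only: vs(2))
  qed
  then show ?thesis
    by (rule linear_span_into[OF lin subspace_mid _ assms(1)[unfolded degree_part_def]])
qed

lemma comult_part_eq: "comult_part T \<iota> \<Delta> a b x = tmap (degree_proj (sc T) \<iota> a) (degree_proj (sc T) \<iota> b) (\<Delta> x)"
  by (simp add: comult_part_def)

text \<open>
  By \<open>Delta_deg\<close> the element \<open>\<Delta> x - x \<otimes> 1 - 1 \<otimes> x\<close> is the sum of the components \<open>\<Delta>\<^sup>a\<^sup>,\<^sup>b x\<close> with
  \<open>a, b \<ge> 1\<close>, so it vanishes as soon as these do.
\<close>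

lemma E_part_primitive_iff:
  assumes n: "n \<ge> 2"
  shows "x \<in> E_part T \<iota> \<Delta> n \<longleftrightarrow> x \<in> deg n \<and> \<Delta> x = x \<otimes> 1 + 1 \<otimes> x"
proof -
  let ?p = "\<lambda>a b. tmap (degree_proj (sc T) \<iota> a) (degree_proj (sc T) \<iota> b)"
  have p: "Vector_Spaces.linear (sc2 T) (sc2 T) (?p a b)"
    "?p a b (x \<otimes> y) = degree_proj (sc T) \<iota> a x \<otimes> degree_proj (sc T) \<iota> b y" for a b x y
    by (rule tmap[OF linear_degree_proj linear_degree_proj])+
  have proj_one: "degree_proj (sc T) \<iota> a 1 = 0" if "a \<ge> 1" for a
    using degree_proj_deg[OF one_deg] that by simp
  have ends: "?p a b (x \<otimes> 1 + 1 \<otimes> x) = 0" if "a \<ge> 1" "b \<ge> 1" for a b x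
    using that by (simp add: linear_rules[OF p(1)] p(2) proj_one tens_rules)
  \<comment> \<open>An element with vanishing components is zero, as it is the sum of its components.\<close>
  have mid_sum: "M = (\<Sum>a\<in>{1..<n}. ?p a (n - a) M)" if "M \<in> mid n" for M
  proof -
    have lin: "Vector_Spaces.linear (sc2 T) (sc2 T) (\<lambda>M. M - (\<Sum>a\<in>{1..<n}. ?p a (n - a) M))"
      unfolding Vector_Spaces.linear_iff
      using T2S.vector_space_axioms
      by (simp add: linear_rules[OF p(1)] sum.distrib T2S.scale_sum_right T2S.scale_right_diff_distrib)
    have "M - (\<Sum>a\<in>{1..<n}. ?p a (n - a) M) \<in> {0}"
    proof (rule linear_span_into[OF lin T2S.subspace_single_0 _ that[unfolded mid_def]])
      fix Z assume "Z \<in> {x \<otimes> y | x y a b. x \<in> deg a \<and> y \<in> deg b \<and> 1 \<le> a \<and> 1 \<le> b \<and> a + b = n}"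
      then obtain x y a b where *: "Z = x \<otimes> y" "x \<in> deg a" "y \<in> deg b" "1 \<le> a" "1 \<le> b" "a + b = n"
        by blast
      have "(\<Sum>i\<in>{1..<n}. ?p i (n - i) Z) = (\<Sum>i\<in>{1..<n}. if i = a then Z else 0)"
        using * degree_proj_deg[OF *(2)] degree_proj_deg[OF *(3)]
        by (intro sum.cong) (auto simp: p(2) tens_rules)
      also have "\<dots> = Z" using * by simp
      finally show "Z - (\<Sum>i\<in>{1..<n}. ?p i (n - i) Z) \<in> {0}" by simp
    qed
    then show ?thesis by simp
  qed
  show ?thesis
  proof
    assume E: "x \<in> E_part T \<iota> \<Delta> n"
    then have E0: "?p a b (\<Delta> x) = 0" if "a \<ge> 1" "b \<ge> 1" "a + b = n" for a b
      using that unfolding E_part_def comult_part_eq by blast+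
    have x: "x \<in> deg n" using E unfolding E_part_def by blast
    define M where "M = \<Delta> x - x \<otimes> 1 - 1 \<otimes> x"
    have zero: "?p a (n - a) M = 0" if "a \<in> {1..<n}" for a
    proof -
      have "\<Delta> x = M + (x \<otimes> 1 + 1 \<otimes> x)" by (simp add: M_def)
      then have "?p a (n - a) (\<Delta> x) = ?p a (n - a) M + ?p a (n - a) (x \<otimes> 1 + 1 \<otimes> x)"
        by (simp only: linear_rules(1)[OF p(1)])
      moreover have "1 \<le> a" "1 \<le> n - a" "a + (n - a) = n" using that by auto
      ultimately show ?thesis using E0[of a "n - a"] ends[of a "n - a" x] by simp
    qed
    have "M \<in> mid n" unfolding M_def using Delta_deg[OF x] n by simp
    then have "M = (\<Sum>a\<in>{1..<n}. ?p a (n - a) M)" by (rule mid_sum)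
    also have "\<dots> = 0" by (rule sum.neutral) (use zero in blast)
    finally have "M = 0" .
    then show "x \<in> deg n \<and> \<Delta> x = x \<otimes> 1 + 1 \<otimes> x"
      using x by (simp add: M_def algebra_simps)
  next
    assume "x \<in> deg n \<and> \<Delta> x = x \<otimes> 1 + 1 \<otimes> x"
    then show "x \<in> E_part T \<iota> \<Delta> n"
      unfolding E_part_def comult_part_eq using ends by simp
  qed
qed

section \<open>Elements of degree two\<close>

lemma lmult_tspan:
  assumes "\<And>x. x \<in> P \<Longrightarrow> a * x \<in> P'" "Z \<in> tspan P Q"
  shows "lmult a Z \<in> tspan P' Q"
  by (rule tspan_into[OF lmult(1) subspace_tspan _ assms(2)]) (simp add: lmult assms(1) tens_tspan)

lemma rmult_tspan:
  assumes "\<And>y. y \<in> Q \<Longrightarrow> y * b \<in> Q'" "Z \<in> tspan P Q"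
  shows "rmult b Z \<in> tspan P Q'"
  by (rule tspan_into[OF rmult(1) subspace_tspan _ assms(2)]) (simp add: rmult assms(1) tens_tspan)

lemma subspace_ideal:
  assumes "two_sided_ideal I" shows "TS.subspace I"
proof (rule TS.subspaceI)
  show "sc T r x \<in> I" if "x \<in> I" for r x
  proof -
    have "sc T r x = sc T r 1 * x" using scale_mult_left[of r 1 x] by simp
    with that assms show ?thesis unfolding two_sided_ideal_def by metis
  qed
qed (use assms in \<open>auto simp: two_sided_ideal_def\<close>)

abbreviation incl2 where "incl2 \<equiv> tens2_incl V (sc T) \<iota>"

lemma incl2: "Vector_Spaces.linear (sc2 V) (sc T) incl2" "incl2 (tens V v w) = \<iota> v * \<iota> w"
  unfolding tens2_incl_def
  using tensor_lift[OF V.tensor_11 space_T bilinear_map_comp[OF bilinear_times linear_iota linear_iota]] by auto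

lemma mulT_iota2: "mulT (iota2 z) = incl2 z"
  by (rule tensor_linear_eq[OF V.tensor_11 linear_comp[OF iota2(1) mulT_linear] incl2(1)])
    (simp add: iota2 mulT incl2)

lemma incl2_deg: "incl2 z \<in> deg 2"
proof -
  have "\<iota> x * \<iota> y \<in> deg 2" for x y
    using iota_mult_deg[OF iota_deg, of x y] by (simp add: numeral_2_eq_2)
  then show ?thesis
    by (induction z rule: tensor_induct[OF V.tensor_11])
      (simp_all add: incl2 linear_rules[OF incl2(1)] TS.subspace_add[OF subspace_deg])
qed

text \<open>
  In degree two the inner component of \<open>\<Delta>\<close> is \<open>1 + c\<close>, whence \<open>E\<^sub>2 = ker (c + 1)\<close>.
\<close>

lemma Delta_incl2: "\<Delta> (incl2 z) = incl2 z \<otimes> 1 + 1 \<otimes> incl2 z + iota2 (z + c z)"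
proof -
  have lin: "Vector_Spaces.linear (sc2 V) (sc2 T) (\<lambda>z. \<Delta> (incl2 z))"
    by (rule linear_comp[OF incl2(1) T.linear_\<Delta>])
  have lin': "Vector_Spaces.linear (sc2 V) (sc2 T) (\<lambda>z. incl2 z \<otimes> 1 + 1 \<otimes> incl2 z + iota2 (z + c z))"
    by (intro linear_plus_minus(1) linear_comp[OF incl2(1) bilinear_map_linear(1)[OF tens_bilinear]]
        linear_comp[OF incl2(1) bilinear_map_linear(2)[OF tens_bilinear]]
        linear_comp[OF linear_plus_minus(1)[OF linear_identity(2)[OF V2S.vector_space_axioms] V.linear_braiding] iota2(1)])
  have "\<Delta> (incl2 (tens V x y)) = incl2 (tens V x y) \<otimes> 1 + 1 \<otimes> incl2 (tens V x y) + iota2 (tens V x y + c (tens V x y))" for x y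
    by (simp add: incl2 Delta_iota_mult primitive linear_rules[OF lmult(1)] bmul_rules bmul_iota_unit lmult
        cT_extends linear_rules[OF iota2(1)] iota2)
  then show ?thesis by (rule tensor_linear_eq[OF V.tensor_11 lin lin'])
qed

abbreviation c1 where "c1 \<equiv> act12 V c"
abbreviation c2 where "c2 \<equiv> act23 V c"

lemmas c12_linear = V.linear_act12[OF V.linear_braiding] V.linear_act23[OF V.linear_braiding]
lemmas c12_apply = V.act12_apply[OF V.linear_braiding] V.act23_apply[OF V.linear_braiding]
lemmas tens12_linear = bilinear_map_linear[OF tensor_product_bilinear[OF V.tensor_12]]
lemmas tens21_linear = bilinear_map_linear[OF tensor_product_bilinear[OF V.tensor_21]]

abbreviation iota_tensor :: "('v2 \<Rightarrow> 't) \<Rightarrow> 'v3 \<Rightarrow> 't2"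
  where "iota_tensor f \<equiv> tensor_map (sc3 V) (tens12 V) (sc2 T) (tens T) \<iota> f"

abbreviation tensor_iota :: "('v2 \<Rightarrow> 't) \<Rightarrow> 'v3 \<Rightarrow> 't2"
  where "tensor_iota f \<equiv> tensor_map (sc3 V) (tens21 V) (sc2 T) (tens T) f \<iota>"

lemmas iota_tensor = tensor_map[OF V.tensor_12 T.tensor_11 linear_iota]
lemmas tensor_iota = tensor_map[OF V.tensor_21 T.tensor_11 _ linear_iota]

text \<open>
  Moving \<open>v\<close> past two factors, one after the other, is \<open>c\<^sub>1 c\<^sub>2\<close> on \<open>V \<otimes> V \<otimes> V\<close>; similarly on the other side.
\<close>

lemma cT_incl2_left: "cT (incl2 z \<otimes> \<iota> v) = iota_tensor incl2 (c1 (c2 (tens21 V z v)))"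
proof (rule tensor_linear_eq[OF V.tensor_11])
  show "Vector_Spaces.linear (sc2 V) (sc2 T) (\<lambda>z. cT (incl2 z \<otimes> \<iota> v))"
    by (rule linear_comp[OF linear_comp[OF incl2(1) bilinear_map_linear(1)[OF tens_bilinear]] T.linear_braiding])
  show "Vector_Spaces.linear (sc2 V) (sc2 T) (\<lambda>z. iota_tensor incl2 (c1 (c2 (tens21 V z v))))"
    by (rule linear_comp[OF linear_comp[OF linear_comp[OF tens21_linear(1) c12_linear(2)] c12_linear(1)]
          iota_tensor(1)[OF incl2(1)]])
  fix x y
  have 1: "rmult (\<iota> v') (iota2 Z) = iota_tensor incl2 (tens21 V Z v')" for Z v'
    by (rule tensor_linear_eq[OF V.tensor_11 linear_comp[OF iota2(1) rmult(1)]
          linear_comp[OF tens21_linear(1) iota_tensor(1)[OF incl2(1)]]])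
      (simp add: V.tens_assoc iota_tensor[OF incl2(1)] iota2 rmult incl2)
  have 2: "hexl (\<iota> x) (iota2 Z) = iota_tensor incl2 (c1 (tens12 V x Z))" for Z
    by (rule tensor_linear_eq[OF V.tensor_11 linear_comp[OF iota2(1) linear_hexl]
          linear_comp[OF linear_comp[OF tens12_linear(2) c12_linear(1)] iota_tensor(1)[OF incl2(1)]]])
      (simp add: V.tens_assoc[symmetric] c12_apply iota2 hexl_tens cT_extends 1)
  show "cT (incl2 (tens V x y) \<otimes> \<iota> v) = iota_tensor incl2 (c1 (c2 (tens21 V (tens V x y) v)))"
    by (simp add: incl2 cT_mult_left cT_extends V.tens_assoc c12_apply 2)
qed

lemma cT_incl2_right: "cT (\<iota> v \<otimes> incl2 z) = tensor_iota incl2 (c2 (c1 (tens12 V v z)))"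
proof (rule tensor_linear_eq[OF V.tensor_11])
  show "Vector_Spaces.linear (sc2 V) (sc2 T) (\<lambda>z. cT (\<iota> v \<otimes> incl2 z))"
    by (rule linear_comp[OF linear_comp[OF incl2(1) bilinear_map_linear(2)[OF tens_bilinear]] T.linear_braiding])
  show "Vector_Spaces.linear (sc2 V) (sc2 T) (\<lambda>z. tensor_iota incl2 (c2 (c1 (tens12 V v z))))"
    by (rule linear_comp[OF linear_comp[OF linear_comp[OF tens12_linear(2) c12_linear(1)] c12_linear(2)]
          tensor_iota(1)[OF incl2(1)]])
  fix x y
  have 1: "lmult (\<iota> v') (iota2 Z) = tensor_iota incl2 (tens12 V v' Z)" for Z v'
    by (rule tensor_linear_eq[OF V.tensor_11 linear_comp[OF iota2(1) lmult(1)]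
          linear_comp[OF tens12_linear(2) tensor_iota(1)[OF incl2(1)]]])
      (simp add: V.tens_assoc[symmetric] tensor_iota[OF incl2(1)] iota2 lmult incl2)
  have 2: "hexr (\<iota> y) (iota2 Z) = tensor_iota incl2 (c2 (tens21 V Z y))" for Z
    by (rule tensor_linear_eq[OF V.tensor_11 linear_comp[OF iota2(1) linear_hexr]
          linear_comp[OF linear_comp[OF tens21_linear(1) c12_linear(2)] tensor_iota(1)[OF incl2(1)]]])
      (simp add: V.tens_assoc c12_apply iota2 hexr_tens cT_extends 1)
  show "cT (\<iota> v \<otimes> incl2 (tens V x y)) = tensor_iota incl2 (c2 (c1 (tens12 V v (tens V x y))))"
    by (simp add: incl2 cT_mult_right cT_extends V.tens_assoc[symmetric] c12_apply 2)
qed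

lemma braid: "c1 (c2 (c1 Y)) = c2 (c1 (c2 Y))"
  using V.braid_equation by (metis comp_apply)

section \<open>The counit and the degree filtration\<close>

lemma counit_left:
  shows linear_counit_left: "Vector_Spaces.linear (sc2 T) (sc T) (counit_left T \<epsilon>)"
    and counit_left_apply: "counit_left T \<epsilon> (x \<otimes> y) = sc T (\<epsilon> x) y"
proof -
  have "bilinear_map (sc T) (sc T) (sc T) (\<lambda>x y. sc T (\<epsilon> x) y)"
    unfolding bilinear_map_def Vector_Spaces.linear_iff
    by (simp add: TS.vector_space_axioms linear_rules[OF T.linear_\<epsilon>] TS.scale_left_distrib
        TS.scale_right_distrib mult.commute)
  from tensor_lift[OF T.tensor_11 space_T this]
  show "Vector_Spaces.linear (sc2 T) (sc T) (counit_left T \<epsilon>)" "counit_left T \<epsilon> (x \<otimes> y) = sc T (\<epsilon> x) y"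
    unfolding counit_left_def by auto
qed

lemma counit_Delta: "counit_left T \<epsilon> (\<Delta> x) = x"
  using T.counital_left by (metis comp_apply id_apply)

text \<open>
  Applying \<open>\<epsilon> \<otimes> T\<close> to \<open>\<Delta> x = x \<otimes> 1 + 1 \<otimes> x\<close> gives \<open>x = \<epsilon> x + x\<close>.
\<close>

lemma primitive_counit:
  assumes "\<Delta> x = x \<otimes> 1 + 1 \<otimes> x" shows "\<epsilon> x = 0"
  using counit_Delta[of x] assms
  by (simp add: linear_rules[OF linear_counit_left] counit_left_apply epsilon_simps)

lemma span_Un_subspaces:
  assumes "TS.subspace A" "TS.subspace B" "x \<in> TS.span (A \<union> B)"
  shows "\<exists>y\<in>A. \<exists>z\<in>B. x = y + z"
proof -
  have span: "TS.span A = A" "TS.span B = B"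
    using assms(1,2) by (simp_all only: TS.span_eq_iff)
  show ?thesis using assms(3) unfolding TS.span_Un span by blast
qed

definition fil :: "nat \<Rightarrow> 't set"
  where "fil n = TS.span (\<Union>i<n. deg i)"

lemma subspace_fil: "TS.subspace (fil n)"
  unfolding fil_def by (rule TS.subspace_span)

lemma deg_fil: "x \<in> deg i \<Longrightarrow> i < n \<Longrightarrow> x \<in> fil n"
  unfolding fil_def by (rule TS.span_base) blast

lemma fil_Suc:
  assumes "x \<in> fil (Suc n)"
  obtains w l where "w \<in> deg n" "l \<in> fil n" "x = w + l"
proof -
  have "(\<Union>i<Suc n. deg i) \<subseteq> deg n \<union> fil n"
    using deg_fil by (auto simp: less_Suc_eq)
  then have "x \<in> TS.span (deg n \<union> fil n)"
    using assms TS.span_mono unfolding fil_def[of "Suc n"] by blast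
  from span_Un_subspaces[OF subspace_deg subspace_fil this] that show ?thesis by blast
qed

lemma fil_one:
  assumes "x \<in> fil (Suc 0)" obtains r where "x = sc T r 1"
proof -
  have "{prod_list (map \<iota> vs) |vs. length vs = 0} = {1}" by auto
  then have "fil (Suc 0) = TS.span (TS.span {1})"
    unfolding fil_def degree_part_def lessThan_Suc lessThan_0 by (simp only: UN_insert UN_empty Un_empty_right)
  also have "\<dots> = range (\<lambda>r. sc T r 1)"
    by (rule trans[OF TS.span_span TS.span_singleton])
  finally have "fil (Suc 0) = range (\<lambda>r. sc T r 1)" .
  then show ?thesis using assms that by auto
qed

lemma deg_one:
  assumes "x \<in> deg (Suc 0)" obtains v where "x = \<iota> v"
proof -
  have "{prod_list (map \<iota> vs) |vs. length vs = Suc 0} = range \<iota>"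
    by (force simp: length_Suc_conv)
  moreover have "TS.span (range \<iota>) = range \<iota>"
    using subspace_range[OF linear_iota] by (simp only: TS.span_eq_iff)
  ultimately have "x \<in> range \<iota>"
    using assms unfolding degree_part_def by (simp only:)
  then show ?thesis using that by blast
qed

lemma mulT_rmult: "mulT (rmult y Z) = mulT Z * y"
  by (rule tensor_linear_eq[OF T.tensor_11 linear_comp[OF rmult(1) mulT_linear]
        linear_comp[OF mulT_linear linear_times_right]])
    (simp add: rmult mulT mult.assoc)

text \<open>
  In degree \<open>n\<close> the component of \<open>T \<otimes> T\<close> whose left factor has degree one, and the sum of those whose
  left factor has degree at least two.
\<close>

definition first :: "nat \<Rightarrow> 't2 set"
  where "first n = T2S.span {\<iota> v \<otimes> t | v t j. t \<in> deg j \<and> Suc j = n}"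

definition high :: "nat \<Rightarrow> 't2 set"
  where "high n = T2S.span {s \<otimes> t | s t i j. s \<in> deg i \<and> t \<in> deg j \<and> 2 \<le> i \<and> i + j = n}"

lemma subspace_first: "T2S.subspace (first n)" and subspace_high: "T2S.subspace (high n)"
  unfolding first_def high_def by (rule T2S.subspace_span)+

lemma tens_first: "t \<in> deg j \<Longrightarrow> \<iota> v \<otimes> t \<in> first (Suc j)"
  unfolding first_def by (rule T2S.span_base) blast

lemma tspan_high: "2 \<le> i \<Longrightarrow> i + j = n \<Longrightarrow> tspan (deg i) (deg j) \<subseteq> high n"
  unfolding high_def tspan_def by (intro T2S.span_mono) blast

lemma first_into:
  assumes "Vector_Spaces.linear (sc2 T) s f" "module.subspace s W"
    and "\<And>v t j. t \<in> deg j \<Longrightarrow> n = Suc j \<Longrightarrow> f (\<iota> v \<otimes> t) \<in> W" and "Z \<in> first n"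
  shows "f Z \<in> W"
  by (rule linear_span_into[OF assms(1,2) _ assms(4)[unfolded first_def]]) (use assms(3) in blast)

lemma high_into:
  assumes "Vector_Spaces.linear (sc2 T) s f" "module.subspace s W"
    and "\<And>x t i j. x \<in> deg i \<Longrightarrow> t \<in> deg j \<Longrightarrow> 2 \<le> i \<Longrightarrow> n = i + j \<Longrightarrow> f (x \<otimes> t) \<in> W" and "Z \<in> high n"
  shows "f Z \<in> W"
  by (rule linear_span_into[OF assms(1,2) _ assms(4)[unfolded high_def]]) (use assms(3) in blast)

end

section \<open>Hecke relations and the bracket\<close>

locale hecke_lie_algebra = braided_lie_algebra V c T \<iota> \<Delta> \<epsilon> cT b
  for V :: "('k::field, 'v::ab_group_add, 'v2::ab_group_add, 'v3::ab_group_add) cube_data"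
    and c :: "'v2 \<Rightarrow> 'v2"
    and T :: "('k, 't::ring_1, 't2::ab_group_add, 't3::ab_group_add, 't4::ab_group_add) fourth_data"
    and \<iota> :: "'v \<Rightarrow> 't"
    and \<Delta> :: "'t \<Rightarrow> 't2" and \<epsilon> :: "'t \<Rightarrow> 'k" and cT :: "'t2 \<Rightarrow> 't2" and b :: "'t \<Rightarrow> 'v" +
  fixes q :: 'k
  assumes hecke: "hecke_type V c q"
    and regular: "regular_mark q"
begin

lemma inj_iota: "inj \<iota>"
  using i_U_inj unfolding inj_def i_U_def by metis

abbreviation E where "E \<equiv> E_space T \<iota> \<Delta>"

lemma subspace_E: "TS.subspace E"
  unfolding E_space_def by (rule TS.subspace_span)

text \<open>
  The elements \<open>rel z\<close> are the relations of the quantum symmetric algebra of \<open>V\<close>, \<open>beta\<close> is the bracket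
  \<open>[-]\<^sub>b\<close>, and the elements \<open>gen z\<close> generate the ideal in the asserted presentation.
\<close>

definition rel :: "'v2 \<Rightarrow> 't"
  where "rel z = incl2 (c z - sc2 V q z)"

definition beta :: "'v2 \<Rightarrow> 'v"
  where "beta z = b (rel z)"

definition gen :: "'v2 \<Rightarrow> 't"
  where "gen z = rel z - \<iota> (beta z)"

lemma linear_c_minus_q: "Vector_Spaces.linear (sc2 V) (sc2 V) (\<lambda>z. c z - sc2 V q z)"
  by (rule linear_plus_minus(2)[OF V.linear_braiding
        linear_plus_minus(3)[OF linear_identity(2)[OF V2S.vector_space_axioms] V.linear_braiding]])

lemma linear_rel: "Vector_Spaces.linear (sc2 V) (sc T) rel"
  unfolding rel_def by (rule linear_comp[OF linear_c_minus_q incl2(1)])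

lemma hecke_eq: "c (c z - sc2 V q z) = - (c z - sc2 V q z)"
  using hecke unfolding hecke_type_def by (metis add_eq_0_iff2 add.commute)

lemma c_square: "c (c z) = sc2 V (q - 1) (c z) + sc2 V q z"
  using hecke_eq[of z]
  by (simp add: linear_rules[OF V.linear_braiding] V2S.scale_left_diff_distrib algebra_simps)

lemma Delta_rel: "\<Delta> (rel z) = rel z \<otimes> 1 + 1 \<otimes> rel z"
  unfolding rel_def Delta_incl2 hecke_eq by (simp add: linear_rules[OF iota2(1)])

lemma rel_deg: "rel z \<in> deg 2"
  unfolding rel_def by (rule incl2_deg)

lemma rel_E: "rel z \<in> E"
proof -
  have "rel z \<in> E_part T \<iota> \<Delta> 2"
    using E_part_primitive_iff[of 2] rel_deg Delta_rel by simp
  then show ?thesis unfolding E_space_def by (intro TS.span_base) auto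
qed

lemma b_linear_on_E:
  shows "x \<in> E \<Longrightarrow> y \<in> E \<Longrightarrow> b (x + y) = b x + b y" and "x \<in> E \<Longrightarrow> b (sc T r x) = sc V r (b x)"
  using bracket unfolding is_bracket_def Let_def by blast+

text \<open>
  The two maps denote \<open>b \<otimes> V\<close> and \<open>V \<otimes> b\<close>.  They exist because \<open>b\<close> extends to a linear map on \<open>T\<close> and the
  injective map \<open>\<iota>\<close> has a linear left inverse.
\<close>

lemma bracket_braiding:
  "\<exists>bV Vb. Vector_Spaces.linear (sc2 T) (sc2 V) bV \<and> Vector_Spaces.linear (sc2 T) (sc2 V) Vb \<and>
    (\<forall>x\<in>E. \<forall>v. bV (x \<otimes> \<iota> v) = tens V (b x) v \<and> Vb (\<iota> v \<otimes> x) = tens V v (b x) \<and>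
      c (tens V (b x) v) = Vb (cT (x \<otimes> \<iota> v)) \<and> c (tens V v (b x)) = bV (cT (\<iota> v \<otimes> x)))"
proof -
  let ?EV = "T2S.span {x \<otimes> \<iota> v | x v. x \<in> E}" and ?VE = "T2S.span {\<iota> v \<otimes> x | v x. x \<in> E}"
  let ?bV = "tensor_lift_on E (range \<iota>) (sc2 T) (tens T) (sc2 V) (\<lambda>x w. tens V (b x) (inv \<iota> w))"
  let ?Vb = "tensor_lift_on (range \<iota>) E (sc2 T) (tens T) (sc2 V) (\<lambda>w x. tens V (inv \<iota> w) (b x))"
  have comm: "c (?bV Z) = ?Vb (cT Z)" if "Z \<in> ?EV" for Z
    using bracket that unfolding is_bracket_def Let_def by blast
  have comm': "c (?Vb Z) = ?bV (cT Z)" if "Z \<in> ?VE" for Z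
    using bracket that unfolding is_bracket_def Let_def by blast
  obtain b' where b': "Vector_Spaces.linear (sc T) (sc V) b'" "\<And>x. x \<in> E \<Longrightarrow> b' x = b x"
    using linear_extension_from_subspace[OF space_T space_V subspace_E, of b] b_linear_on_E by blast
  interpret P: vector_space_pair "sc V" "sc T" ..
  obtain j where j: "Vector_Spaces.linear (sc T) (sc V) j" "j \<circ> \<iota> = id"
    using P.linear_injective_left_inverse[OF linear_iota inj_iota] by blast
  have j_inv: "j w = inv \<iota> w" if "w \<in> range \<iota>" for w
    using that j(2) inv_f_f[OF inj_iota] by (auto simp: fun_eq_iff)
  note V_bil = tensor_product_bilinear[OF V.tensor_11]
  note bV = tensor_lift_on_apply[OF T.tensor_11 V2S.vector_space_axioms bilinear_map_comp[OF V_bil b'(1) j(1)],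
      where S = E and S' = "range \<iota>" and \<beta> = "\<lambda>x w. tens V (b x) (inv \<iota> w)"]
  note Vb = tensor_lift_on_apply[OF T.tensor_11 V2S.vector_space_axioms bilinear_map_comp[OF V_bil j(1) b'(1)],
      where S = "range \<iota>" and S' = E and \<beta> = "\<lambda>w x. tens V (inv \<iota> w) (b x)"]
  have bV': "Vector_Spaces.linear (sc2 T) (sc2 V) ?bV" "x \<in> E \<Longrightarrow> ?bV (x \<otimes> \<iota> v) = tens V (b x) v" for x v
    using bV(1) bV(2)[of _ "\<iota> v"] by (simp_all add: b'(2) j_inv inv_f_f[OF inj_iota])
  have Vb': "Vector_Spaces.linear (sc2 T) (sc2 V) ?Vb" "x \<in> E \<Longrightarrow> ?Vb (\<iota> v \<otimes> x) = tens V v (b x)" for x v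
    using Vb(1) Vb(2)[of "\<iota> v"] by (simp_all add: b'(2) j_inv inv_f_f[OF inj_iota])
  have mem: "x \<otimes> \<iota> v \<in> ?EV" "\<iota> v \<otimes> x \<in> ?VE" if "x \<in> E" for x v
    by (rule T2S.span_base; use that in blast)+
  have "c (tens V (b x) v) = ?Vb (cT (x \<otimes> \<iota> v))" if "x \<in> E" for x v
    using comm[OF mem(1)[OF that]] bV'(2)[OF that] by simp
  moreover have "c (tens V v (b x)) = ?bV (cT (\<iota> v \<otimes> x))" if "x \<in> E" for x v
    using comm'[OF mem(2)[OF that]] Vb'(2)[OF that] by simp
  ultimately show ?thesis
    using bV' Vb' by (intro exI[of _ ?bV] exI[of _ ?Vb]) simp
qed

lemma linear_beta: "Vector_Spaces.linear (sc2 V) (sc V) beta"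
  unfolding Vector_Spaces.linear_iff beta_def
  using VS.vector_space_axioms V2S.vector_space_axioms rel_E b_linear_on_E
  by (simp add: linear_rules[OF linear_rel])

lemma linear_gen: "Vector_Spaces.linear (sc2 V) (sc T) gen"
  unfolding gen_def by (rule linear_plus_minus(2)[OF linear_rel linear_comp[OF linear_beta linear_iota]])

text \<open>
  The braid equation turns \<open>c\<^sub>1 c\<^sub>2 (c\<^sub>1 - q)\<close> into \<open>(c\<^sub>2 - q) c\<^sub>1 c\<^sub>2\<close>, so \<open>V\<close> moves past the relations.
\<close>

lemma cT_rel_left: "cT (rel z \<otimes> \<iota> v) = iota_tensor rel (c1 (c2 (tens21 V z v)))"
proof -
  note tens21_rules = linear_rules[OF tens21_linear(1)]
  note rules = linear_rules[OF c12_linear(1)] linear_rules[OF c12_linear(2)]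
  let ?X = "c1 (c2 (tens21 V z v))"
  have "cT (rel z \<otimes> \<iota> v) = iota_tensor incl2 (c2 ?X - sc3 V q ?X)"
    unfolding rel_def cT_incl2_left tens21_rules rules
    unfolding c12_apply(1)[symmetric] braid ..
  also have "\<dots> = iota_tensor rel ?X"
  proof (rule tensor_linear_eq[OF V.tensor_12])
    show "Vector_Spaces.linear (sc3 V) (sc2 T) (\<lambda>X. iota_tensor incl2 (c2 X - sc3 V q X))"
      by (rule linear_comp[OF _ iota_tensor(1)[OF incl2(1)]])
        (intro linear_plus_minus(2)[OF c12_linear(2)] linear_plus_minus(3)[OF _ c12_linear(2)]
          linear_identity V.cube_spaces)
    show "Vector_Spaces.linear (sc3 V) (sc2 T) (iota_tensor rel)"
      by (rule iota_tensor(1)[OF linear_rel])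
  qed (simp add: c12_apply rel_def[symmetric] iota_tensor[OF linear_rel] iota_tensor[OF incl2(1)]
      linear_rules[OF tens12_linear(2), symmetric])
  finally show ?thesis .
qed

lemma cT_rel_right: "cT (\<iota> v \<otimes> rel z) = tensor_iota rel (c2 (c1 (tens12 V v z)))"
proof -
  note tens12_rules = linear_rules[OF tens12_linear(2)]
  note rules = linear_rules[OF c12_linear(1)] linear_rules[OF c12_linear(2)]
  let ?X = "c2 (c1 (tens12 V v z))"
  have "cT (\<iota> v \<otimes> rel z) = tensor_iota incl2 (c1 ?X - sc3 V q ?X)"
    unfolding rel_def cT_incl2_right tens12_rules rules
    unfolding c12_apply(2)[symmetric] braid ..
  also have "\<dots> = tensor_iota rel ?X"
  proof (rule tensor_linear_eq[OF V.tensor_21])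
    show "Vector_Spaces.linear (sc3 V) (sc2 T) (\<lambda>X. tensor_iota incl2 (c1 X - sc3 V q X))"
      by (rule linear_comp[OF _ tensor_iota(1)[OF incl2(1)]])
        (intro linear_plus_minus(2)[OF c12_linear(1)] linear_plus_minus(3)[OF _ c12_linear(1)]
          linear_identity V.cube_spaces)
    show "Vector_Spaces.linear (sc3 V) (sc2 T) (tensor_iota rel)"
      by (rule tensor_iota(1)[OF linear_rel])
  qed (simp add: c12_apply rel_def[symmetric] tensor_iota[OF linear_rel] tensor_iota[OF incl2(1)]
      linear_rules[OF tens21_linear(1), symmetric])
  finally show ?thesis .
qed

abbreviation betaV where "betaV \<equiv> mult_left V beta"
abbreviation Vbeta where "Vbeta \<equiv> mult_right V beta"
lemmas betaV = V.mult_left[OF linear_beta]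
lemmas Vbeta = V.mult_right[OF linear_beta]

text \<open>
  The compatibility of the bracket with the braiding, transported along \<open>rel\<close>.
\<close>

lemma c_beta:
  shows c_betaV: "c (betaV Y) = Vbeta (c1 (c2 Y))" and c_Vbeta: "c (Vbeta Y) = betaV (c2 (c1 Y))"
proof -
  obtain bV Vb where linear: "Vector_Spaces.linear (sc2 T) (sc2 V) bV" "Vector_Spaces.linear (sc2 T) (sc2 V) Vb"
    and all: "\<forall>x\<in>E. \<forall>v. bV (x \<otimes> \<iota> v) = tens V (b x) v \<and> Vb (\<iota> v \<otimes> x) = tens V v (b x) \<and>
      c (tens V (b x) v) = Vb (cT (x \<otimes> \<iota> v)) \<and> c (tens V v (b x)) = bV (cT (\<iota> v \<otimes> x))"
    using bracket_braiding by blast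
  have bV: "bV (x \<otimes> \<iota> v) = tens V (b x) v" and Vb: "Vb (\<iota> v \<otimes> x) = tens V v (b x)"
    and comm: "c (tens V (b x) v) = Vb (cT (x \<otimes> \<iota> v))" "c (tens V v (b x)) = bV (cT (\<iota> v \<otimes> x))"
    if "x \<in> E" for x v
    using all that by blast+
  have Vb_rel: "Vb (iota_tensor rel X) = Vbeta X" for X
    by (rule tensor_linear_eq[OF V.tensor_12 linear_comp[OF iota_tensor(1)[OF linear_rel] linear(2)] Vbeta(1)])
      (simp add: iota_tensor[OF linear_rel] Vb[OF rel_E] Vbeta beta_def)
  have bV_rel: "bV (tensor_iota rel X) = betaV X" for X
    by (rule tensor_linear_eq[OF V.tensor_21 linear_comp[OF tensor_iota(1)[OF linear_rel] linear(1)] betaV(1)])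
      (simp add: tensor_iota[OF linear_rel] bV[OF rel_E] betaV beta_def)
  show "c (betaV Y) = Vbeta (c1 (c2 Y))"
  proof (rule tensor_linear_eq[OF V.tensor_21 linear_comp[OF betaV(1) V.linear_braiding]
        linear_comp[OF linear_comp[OF c12_linear(2) c12_linear(1)] Vbeta(1)]])
    show "c (betaV (tens21 V z v)) = Vbeta (c1 (c2 (tens21 V z v)))" for z v
      using comm(1)[OF rel_E, of z v] by (simp add: betaV beta_def cT_rel_left Vb_rel)
  qed
  show "c (Vbeta Y) = betaV (c2 (c1 Y))"
  proof (rule tensor_linear_eq[OF V.tensor_12 linear_comp[OF Vbeta(1) V.linear_braiding]
        linear_comp[OF linear_comp[OF c12_linear(1) c12_linear(2)] betaV(1)]])
    show "c (Vbeta (tens12 V v z)) = betaV (c2 (c1 (tens12 V v z)))" for z v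
      using comm(2)[OF rel_E, of v z] by (simp add: Vbeta beta_def cT_rel_right bV_rel)
  qed
qed

lemma gen_tens: "t \<otimes> gen z = t \<otimes> rel z - t \<otimes> \<iota> (beta z)" "gen z \<otimes> t = rel z \<otimes> t - \<iota> (beta z) \<otimes> t"
  by (simp_all add: gen_def tens_rules)

lemma iota_tensor_gen: "iota_tensor gen X \<in> tspan UNIV (range gen)"
  by (induction X rule: tensor_induct[OF V.tensor_12])
    (auto simp: iota_tensor[OF linear_gen] linear_rules[OF iota_tensor(1)[OF linear_gen]]
      intro: tens_tspan T2S.subspace_add[OF subspace_tspan])

lemma tensor_iota_gen: "tensor_iota gen X \<in> tspan (range gen) UNIV"
  by (induction X rule: tensor_induct[OF V.tensor_21])
    (auto simp: tensor_iota[OF linear_gen] linear_rules[OF tensor_iota(1)[OF linear_gen]]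
      intro: tens_tspan T2S.subspace_add[OF subspace_tspan])

lemma cT_gen_left: "cT (gen z \<otimes> \<iota> v) = iota_tensor gen (c1 (c2 (tens21 V z v)))"
proof -
  let ?X = "c1 (c2 (tens21 V z v))"
  have "cT (gen z \<otimes> \<iota> v) = iota_tensor rel ?X - iota2 (Vbeta ?X)"
    using c_betaV[of "tens21 V z v"]
    by (simp add: gen_def tens_rules cT_rules cT_extends cT_rel_left betaV)
  also have "\<dots> = iota_tensor gen ?X"
    by (rule tensor_linear_eq[OF V.tensor_12 linear_plus_minus(2)[OF iota_tensor(1)[OF linear_rel]
          linear_comp[OF Vbeta(1) iota2(1)]] iota_tensor(1)[OF linear_gen]])
      (simp add: iota_tensor[OF linear_rel] iota_tensor[OF linear_gen] iota2 Vbeta gen_tens[symmetric])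
  finally show ?thesis .
qed

lemma cT_gen_right: "cT (\<iota> v \<otimes> gen z) = tensor_iota gen (c2 (c1 (tens12 V v z)))"
proof -
  let ?X = "c2 (c1 (tens12 V v z))"
  have "cT (\<iota> v \<otimes> gen z) = tensor_iota rel ?X - iota2 (betaV ?X)"
    using c_Vbeta[of "tens12 V v z"]
    by (simp add: gen_def tens_rules cT_rules cT_extends cT_rel_right Vbeta)
  also have "\<dots> = tensor_iota gen ?X"
    by (rule tensor_linear_eq[OF V.tensor_21 linear_plus_minus(2)[OF tensor_iota(1)[OF linear_rel]
          linear_comp[OF betaV(1) iota2(1)]] tensor_iota(1)[OF linear_gen]])
      (simp add: tensor_iota[OF linear_rel] tensor_iota[OF linear_gen] iota2 betaV gen_tens[symmetric])
  finally show ?thesis .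
qed

section \<open>The ideal of the Hecke relations is a coideal\<close>

definition J :: "'t set" where "J = two_sided_ideal hull (range gen)"

lemma ideal_J: "two_sided_ideal J"
  unfolding J_def by (rule two_sided_ideal_hull)

lemma J_rules: "0 \<in> J" "x \<in> J \<Longrightarrow> y \<in> J \<Longrightarrow> x + y \<in> J" "x \<in> J \<Longrightarrow> a * x \<in> J" "x \<in> J \<Longrightarrow> x * a \<in> J"
  using ideal_J unfolding two_sided_ideal_def by blast+

lemma gen_J: "gen z \<in> J"
  unfolding J_def by (rule hull_inc) blast

lemma J_induct [consumes 1, case_names gen zero add left right]:
  assumes "x \<in> J" and "\<And>z. P (gen z)" "P 0" "\<And>x y. P x \<Longrightarrow> P y \<Longrightarrow> P (x + y)"
    "\<And>a x. P x \<Longrightarrow> P (a * x)" "\<And>a x. P x \<Longrightarrow> P (x * a)"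
  shows "P x"
  using assms(1) unfolding J_def
  by (rule hull_induct) (use assms in \<open>auto simp: two_sided_ideal_def\<close>)

text \<open>
  For \<open>t \<in> V\<close> this is \<open>cT_gen_left\<close>, and the set of all such \<open>t\<close> is a subalgebra, because one can move
  a product one factor at a time.
\<close>

lemma cT_gen_flip_left: "cT (gen z \<otimes> t) \<in> tspan UNIV (range gen)"
proof (induction t arbitrary: z rule: generated_by_V)
  case one
  then show ?case by (simp add: cT_unit tens_tspan)
next
  case (iota v)
  show ?case unfolding cT_gen_left
    by (rule iota_tensor_gen)
next
  case (mult x y)
  show ?case unfolding cT_mult_right
  proof (rule tspan_into[OF linear_hexr subspace_tspan _ mult(1)])
    show "hexr y (t \<otimes> g) \<in> tspan UNIV (range gen)" if "g \<in> range gen" for t g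
      using that mult(2) by (auto simp: hexr_tens intro: lmult_tspan[of UNIV])
  qed
qed (simp_all add: tens_rules cT_rules T2S.subspace_add[OF subspace_tspan] T2S.subspace_scale[OF subspace_tspan])

lemma cT_gen_flip_right: "cT (t \<otimes> gen z) \<in> tspan (range gen) UNIV"
proof (induction t arbitrary: z rule: generated_by_V)
  case one
  then show ?case by (simp add: cT_unit tens_tspan)
next
  case (iota v)
  show ?case unfolding cT_gen_right
    by (rule tensor_iota_gen)
next
  case (mult x y)
  show ?case unfolding cT_mult_left
  proof (rule tspan_into[OF linear_hexl subspace_tspan _ mult(2)])
    show "hexl x (g \<otimes> t) \<in> tspan (range gen) UNIV" if "g \<in> range gen" for t g
      using that mult(1) by (auto simp: hexl_tens intro: rmult_tspan[of UNIV])
  qed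
qed (simp_all add: tens_rules cT_rules T2S.subspace_add[OF subspace_tspan] T2S.subspace_scale[OF subspace_tspan])

text \<open>
  The elements \<open>x\<close> with this property form a two-sided ideal, and the generators have it.
\<close>

lemma cT_J_left:
  assumes "x \<in> J" shows "cT (x \<otimes> t) \<in> tspan UNIV J"
  using assms
proof (induction x arbitrary: t rule: J_induct)
  case (gen z)
  then show ?case using cT_gen_flip_left tspan_mono[of UNIV UNIV "range gen" J] gen_J by blast
next
  case (left a x)
  show ?case unfolding cT_mult_left
    by (rule tspan_into[OF linear_hexl subspace_tspan _ left])
      (auto simp: hexl_tens intro: rmult_tspan[OF _ tspan_UNIV] J_rules)
next
  case (right a x)
  show ?case unfolding cT_mult_left
    by (rule tspan_into[OF linear_hexl subspace_tspan _ tspan_UNIV])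
      (auto simp: hexl_tens intro: rmult_tspan[OF _ right] J_rules)
qed (simp_all add: tens_rules cT_rules T2S.subspace_0[OF subspace_tspan] T2S.subspace_add[OF subspace_tspan])

lemma cT_J_right:
  assumes "x \<in> J" shows "cT (t \<otimes> x) \<in> tspan J UNIV"
  using assms
proof (induction x arbitrary: t rule: J_induct)
  case (gen z)
  then show ?case using cT_gen_flip_right tspan_mono[of "range gen" J UNIV UNIV] gen_J by blast
next
  case (right a x)
  show ?case unfolding cT_mult_right
    by (rule tspan_into[OF linear_hexr subspace_tspan _ right])
      (auto simp: hexr_tens intro: lmult_tspan[OF _ tspan_UNIV] J_rules)
next
  case (left a x)
  show ?case unfolding cT_mult_right
    by (rule tspan_into[OF linear_hexr subspace_tspan _ tspan_UNIV])
      (auto simp: hexr_tens intro: lmult_tspan[OF _ left] J_rules)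
qed (simp_all add: tens_rules cT_rules T2S.subspace_0[OF subspace_tspan] T2S.subspace_add[OF subspace_tspan])

text \<open>
  The subspace \<open>J \<otimes> T + T \<otimes> J\<close>.
\<close>

definition K :: "'t2 set"
  where "K = T2S.span {x \<otimes> y | x y. x \<in> J \<or> y \<in> J}"

lemma subspace_K: "T2S.subspace K"
  unfolding K_def by (rule T2S.subspace_span)

lemma tspan_K: "tspan J UNIV \<subseteq> K" "tspan UNIV J \<subseteq> K"
  unfolding K_def tspan_def by (rule T2S.span_mono; blast)+

lemma K_into:
  assumes "Vector_Spaces.linear (sc2 T) s f" "module.subspace s W"
    and "\<And>x y. x \<in> J \<Longrightarrow> f (x \<otimes> y) \<in> W" "\<And>x y. y \<in> J \<Longrightarrow> f (x \<otimes> y) \<in> W" and "Z \<in> K"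
  shows "f Z \<in> W"
  by (rule linear_span_into[OF assms(1,2) _ assms(5)[unfolded K_def]]) (use assms(3,4) in blast)

text \<open>
  In \<open>(a \<otimes> d) (x \<otimes> y)\<close> the factor \<open>y\<close> stays on the right, while \<open>d\<close> and \<open>x\<close> are exchanged by the
  braiding; this is harmless because the braiding exchanges \<open>T \<otimes> J\<close> and \<open>J \<otimes> T\<close>.
\<close>

lemma bmul_K:
  assumes "Z \<in> K" shows "bmul W Z \<in> K" "bmul Z W \<in> K"
proof -
  have left: "bmul (a \<otimes> d) Z \<in> K" for a d
  proof (rule K_into[OF bilinear_map_linear(2)[OF bmul_bilinear] subspace_K _ _ assms])
    show "bmul (a \<otimes> d) (x \<otimes> y) \<in> K" if "x \<in> J" for x y
      unfolding bmul_tens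
      by (rule subsetD[OF tspan_K(1)] lmult_tspan rmult_tspan cT_J_right[OF that] J_rules UNIV_I | assumption)+
    show "bmul (a \<otimes> d) (x \<otimes> y) \<in> K" if "y \<in> J" for x y
      unfolding bmul_tens
      by (rule subsetD[OF tspan_K(2)], rule lmult_tspan[of UNIV], simp, rule rmult_tspan[OF _ tspan_UNIV])
        (rule J_rules that)+
  qed
  have right: "bmul Z (a \<otimes> d) \<in> K" for a d
  proof (rule K_into[OF bilinear_map_linear(1)[OF bmul_bilinear] subspace_K _ _ assms])
    show "bmul (x \<otimes> y) (a \<otimes> d) \<in> K" if "y \<in> J" for x y
      unfolding bmul_tens
      by (rule subsetD[OF tspan_K(2)] lmult_tspan rmult_tspan cT_J_left[OF that] J_rules UNIV_I | assumption)+
    show "bmul (x \<otimes> y) (a \<otimes> d) \<in> K" if "x \<in> J" for x y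
      unfolding bmul_tens
      by (rule subsetD[OF tspan_K(1)], rule lmult_tspan[OF _ tspan_UNIV])
        (rule J_rules that)+
  qed
  show "bmul W Z \<in> K"
    by (induction W rule: tensor_induct[OF T.tensor_11])
      (auto simp: left bmul_rules intro: T2S.subspace_add[OF subspace_K])
  show "bmul Z W \<in> K"
    by (induction W rule: tensor_induct[OF T.tensor_11])
      (auto simp: right bmul_rules intro: T2S.subspace_add[OF subspace_K])
qed

lemma Delta_gen: "\<Delta> (gen z) = gen z \<otimes> 1 + 1 \<otimes> gen z"
  by (simp add: gen_def Delta_rules Delta_rel primitive tens_rules)

text \<open>
  \<open>J\<close> is a coideal: its generators are primitive, and \<open>K\<close> absorbs the braided product.
\<close>

lemma Delta_J: "x \<in> J \<Longrightarrow> \<Delta> x \<in> K"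
proof (induction x rule: J_induct)
  case (gen z)
  have "gen z \<otimes> 1 \<in> K" "1 \<otimes> gen z \<in> K"
    using tspan_K tens_tspan[of "gen z" J 1 UNIV] tens_tspan[of 1 UNIV "gen z" J] gen_J by auto
  then show ?case by (simp add: Delta_gen T2S.subspace_add[OF subspace_K])
qed (simp_all add: Delta_rules Delta_mult bmul_K T2S.subspace_0[OF subspace_K] T2S.subspace_add[OF subspace_K])

section \<open>Leading terms modulo the ideal of the Hecke relations\<close>

text \<open>
  The component of degree \<open>n\<close> of the homogeneous ideal generated by the relations.
\<close>

definition N :: "nat \<Rightarrow> 't set"
  where "N n = TS.span {x * rel z * y | x z y i j. x \<in> deg i \<and> y \<in> deg j \<and> i + 2 + j = n}"

lemma subspace_N: "TS.subspace (N n)"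
  unfolding N_def by (rule TS.subspace_span)

lemma N_into:
  assumes "Vector_Spaces.linear (sc T) s f" "module.subspace s W"
    and "\<And>x z y i j. x \<in> deg i \<Longrightarrow> y \<in> deg j \<Longrightarrow> n = i + 2 + j \<Longrightarrow> f (x * rel z * y) \<in> W" and "x \<in> N n"
  shows "f x \<in> W"
  by (rule linear_span_into[OF assms(1,2) _ assms(4)[unfolded N_def]]) (use assms(3) in blast)

lemma mult_N: "x \<in> deg i \<Longrightarrow> y \<in> deg j \<Longrightarrow> x * rel z * y \<in> N (i + 2 + j)"
  unfolding N_def by (rule TS.span_base) blast

lemma iota_mult_N:
  assumes "x \<in> N n" shows "\<iota> v * x \<in> N (Suc n)"
proof (rule N_into[OF times_linear(2) subspace_N _ assms])
  fix x z y i j assume *: "x \<in> deg i" "y \<in> deg j" "n = i + 2 + j"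
  have "\<iota> v * (x * rel z * y) = (\<iota> v * x) * rel z * y" by (simp add: mult.assoc)
  also have "\<dots> \<in> N (Suc i + 2 + j)" by (rule mult_N[OF iota_mult_deg[OF *(1)] *(2)])
  finally show "\<iota> v * (x * rel z * y) \<in> N (Suc n)" by (simp add: *(3))
qed

text \<open>
  Modulo \<open>J\<close> a relation of degree two equals its bracket, which has degree one.
\<close>

lemma N_lower:
  assumes "x \<in> N n" shows "\<exists>l\<in>deg (n - 1). x - l \<in> J"
proof -
  have "x \<in> TS.span (J \<union> deg (n - 1))"
  proof (rule N_into[OF linear_identity(2)[OF space_T] TS.subspace_span _ assms])
    fix x z y i j assume *: "x \<in> deg i" "y \<in> deg j" "n = i + 2 + j"
    have "x * rel z * y = x * gen z * y + x * \<iota> (beta z) * y"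
      by (simp add: gen_def algebra_simps)
    moreover have "x * gen z * y \<in> J" by (intro J_rules gen_J)
    moreover have "x * \<iota> (beta z) * y \<in> deg (i + 1 + j)"
      by (intro mult_deg * iota_deg)
    ultimately show "x * rel z * y \<in> TS.span (J \<union> deg (n - 1))"
      using * by (auto intro!: TS.span_add intro: TS.span_base)
  qed
  then obtain j l where "j \<in> J" "l \<in> deg (n - 1)" "x = j + l"
    using span_Un_subspaces[OF subspace_ideal[OF ideal_J] subspace_deg] by blast
  then show ?thesis by (intro bexI[of _ l]) simp_all
qed

text \<open>
  The component \<open>A\<close> of \<open>\<Delta> w\<close> in \<open>V \<otimes> T\<^sup>n\<^sup>-\<^sup>1\<close> multiplies to \<open>(n)\<^sub>q w\<close> modulo the relations.  A new letter \<open>v\<close>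
  contributes \<open>v \<otimes> w\<close>, which multiplies to \<open>v w\<close>, and moves each \<open>u \<otimes> t\<close> in \<open>A\<close> to \<open>c (v \<otimes> u)\<close> times \<open>t\<close>,
  which multiplies to \<open>q v u t\<close> modulo the relations; and \<open>1 + q (n)\<^sub>q = (n + 1)\<^sub>q\<close>.
\<close>

lemma Delta_word:
  defines "word \<equiv> \<lambda>vs. prod_list (map \<iota> vs)"
  shows "\<exists>A B. \<Delta> (word vs) = 1 \<otimes> word vs + A + B \<and> A \<in> first (length vs) \<and> B \<in> high (length vs) \<and>
    mulT A - sc T (\<Sum>i<length vs. q ^ i) (word vs) \<in> N (length vs)"
proof (induction vs)
  case Nil
  show ?case
    by (rule exI[of _ 0], rule exI[of _ 0])
      (simp add: word_def Delta_one T2S.subspace_0[OF subspace_first] T2S.subspace_0[OF subspace_high]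
        linear_rules[OF mulT_linear] TS.subspace_0[OF subspace_N])
next
  case (Cons v us)
  let ?n = "length us" and ?w = "word us"
  let ?\<Phi> = "bmul (1 \<otimes> \<iota> v)" and ?q = "\<Sum>i<length us. q ^ i"
  note \<Phi>_linear = bilinear_map_linear(2)[OF bmul_bilinear, of "1 \<otimes> \<iota> v"]
  obtain A B where AB: "\<Delta> ?w = 1 \<otimes> ?w + A + B" "A \<in> first ?n" "B \<in> high ?n" "mulT A - sc T ?q ?w \<in> N ?n"
    using Cons by blast
  have w: "word (v # us) = \<iota> v * ?w" and w_deg: "?w \<in> deg ?n"
    by (simp_all add: word_def word_deg)
  define A' where "A' = \<iota> v \<otimes> ?w + ?\<Phi> A"
  define B' where "B' = lmult (\<iota> v) A + (lmult (\<iota> v) B + ?\<Phi> B)"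
  have "\<Delta> (word (v # us)) = 1 \<otimes> word (v # us) + A' + B'"
    by (simp add: w Delta_iota_mult AB(1) linear_rules[OF lmult(1)] lmult bmul_rules bmul_iota_unit A'_def B'_def)
  moreover have "A' \<in> first (length (v # us))"
  proof -
    have "?\<Phi> A \<in> first (Suc ?n)"
    proof (rule first_into[OF \<Phi>_linear subspace_first _ AB(2)])
      fix u t j assume t: "t \<in> deg j" "?n = Suc j"
      show "?\<Phi> (\<iota> u \<otimes> t) \<in> first (Suc ?n)"
        unfolding bmul_one cT_extends
        by (rule tspan_into[OF rmult(1) subspace_first _ iota2_tspan])
          (auto simp: rmult t(2) intro!: tens_first iota_mult_deg t(1))
    qed
    then show ?thesis
      unfolding A'_def using tens_first[OF w_deg] by (simp add: T2S.subspace_add[OF subspace_first])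
  qed
  moreover have "B' \<in> high (length (v # us))"
  proof -
    have "lmult (\<iota> v) A \<in> high (Suc ?n)"
    proof (rule first_into[OF lmult(1) subspace_high _ AB(2)])
      fix u t j assume t: "t \<in> deg j" "?n = Suc j"
      have "\<iota> v * \<iota> u \<otimes> t \<in> tspan (deg 2) (deg j)"
        using iota_mult_deg[OF iota_deg, of v u] t(1) by (auto simp: numeral_2_eq_2 intro: tens_tspan)
      then show "lmult (\<iota> v) (\<iota> u \<otimes> t) \<in> high (Suc ?n)"
        using tspan_high[of 2 j "Suc ?n"] t(2) by (auto simp: lmult)
    qed
    moreover have "lmult (\<iota> v) B \<in> high (Suc ?n)"
    proof (rule high_into[OF lmult(1) subspace_high _ AB(3)])
      fix x t i j assume *: "x \<in> deg i" "t \<in> deg j" "2 \<le> i" "?n = i + j"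
      have "\<iota> v * x \<otimes> t \<in> tspan (deg (Suc i)) (deg j)"
        using iota_mult_deg[OF *(1)] *(2) by (rule tens_tspan)
      then show "lmult (\<iota> v) (x \<otimes> t) \<in> high (Suc ?n)"
        using tspan_high[of "Suc i" j "Suc ?n"] * by (auto simp: lmult)
    qed
    moreover have "?\<Phi> B \<in> high (Suc ?n)"
    proof (rule high_into[OF \<Phi>_linear subspace_high _ AB(3)])
      fix x t i j assume *: "x \<in> deg i" "t \<in> deg j" "2 \<le> i" "?n = i + j"
      then show "?\<Phi> (x \<otimes> t) \<in> high (Suc ?n)"
        using bmul_iota_deg[OF *(1,2)] tspan_high[of i "Suc j" "Suc ?n"] by auto
    qed
    ultimately show ?thesis
      unfolding B'_def by (simp add: T2S.subspace_add[OF subspace_high])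
  qed
  moreover have "mulT A' - sc T (\<Sum>i<length (v # us). q ^ i) (word (v # us)) \<in> N (length (v # us))"
  proof -
    have lin: "Vector_Spaces.linear (sc2 T) (sc T) (\<lambda>A. mulT (?\<Phi> A) - sc T q (\<iota> v * mulT A))"
      by (rule linear_plus_minus(2)[OF linear_comp[OF \<Phi>_linear mulT_linear]
            linear_plus_minus(3)[OF linear_comp[OF mulT_linear times_linear(2)]
              linear_comp[OF \<Phi>_linear mulT_linear]]])
    have 1: "mulT (?\<Phi> A) - sc T q (\<iota> v * mulT A) \<in> N (Suc ?n)"
    proof (rule first_into[OF lin subspace_N _ AB(2)])
      fix u t j assume t: "t \<in> deg j" "?n = Suc j"
      have "mulT (?\<Phi> (\<iota> u \<otimes> t)) - sc T q (\<iota> v * mulT (\<iota> u \<otimes> t)) = 1 * rel (tens V v u) * t"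
        by (simp add: bmul_one cT_extends mulT_rmult mulT_iota2 mulT rel_def linear_rules[OF incl2(1)]
            incl2 left_diff_distrib scale_mult_left[symmetric] mult.assoc)
      also have "\<dots> \<in> N (0 + 2 + j)" by (rule mult_N[OF one_deg t(1)])
      finally show "mulT (?\<Phi> (\<iota> u \<otimes> t)) - sc T q (\<iota> v * mulT (\<iota> u \<otimes> t)) \<in> N (Suc ?n)"
        by (simp add: t(2))
    qed
    have 2: "sc T q (\<iota> v * (mulT A - sc T ?q ?w)) \<in> N (Suc ?n)"
      by (intro TS.subspace_scale[OF subspace_N] iota_mult_N AB(4))
    have "(\<Sum>i<Suc ?n. q ^ i) = 1 + q * ?q"
      by (simp add: sum.lessThan_Suc_shift sum_distrib_left del: sum.lessThan_Suc)
    then have "mulT A' - sc T (\<Sum>i<length (v # us). q ^ i) (word (v # us))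
      = (mulT (?\<Phi> A) - sc T q (\<iota> v * mulT A)) + sc T q (\<iota> v * (mulT A - sc T ?q ?w))"
      by (simp add: A'_def w mulT linear_rules[OF mulT_linear] TS.scale_left_distrib right_diff_distrib
          TS.scale_right_diff_distrib scale_mult_right[symmetric])
    then show ?thesis using TS.subspace_add[OF subspace_N 1 2] by simp
  qed
  ultimately show ?case by blast
qed

text \<open>
  The elements whose classes modulo \<open>J\<close> are primitive.
\<close>

definition prim :: "'t set"
  where "prim = {x. \<Delta> x - x \<otimes> 1 - 1 \<otimes> x \<in> K}"

lemma subspace_prim: "TS.subspace prim"
proof -
  have "Vector_Spaces.linear (sc T) (sc2 T) (\<lambda>x. \<Delta> x - x \<otimes> 1 - 1 \<otimes> x)"
    by (intro linear_plus_minus T.linear_\<Delta> bilinear_map_linear[OF tens_bilinear])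
  from subspace_preimage[OF this subspace_K] show ?thesis unfolding prim_def .
qed

lemma primitive_prim: "\<Delta> x = x \<otimes> 1 + 1 \<otimes> x \<Longrightarrow> x \<in> prim"
  unfolding prim_def by (simp add: T2S.subspace_0[OF subspace_K])

lemma J_prim: assumes "x \<in> J" shows "x \<in> prim"
proof -
  have "x \<otimes> 1 \<in> K" "1 \<otimes> x \<in> K"
    using tspan_K tens_tspan[of x J 1 UNIV] tens_tspan[of 1 UNIV x J] assms by auto
  then show ?thesis
    unfolding prim_def using Delta_J[OF assms] by (simp add: T2S.subspace_diff[OF subspace_K])
qed

lemma counit_J: "x \<in> J \<Longrightarrow> \<epsilon> x = 0"
  by (induction x rule: J_induct)
    (simp_all add: primitive_counit Delta_gen epsilon_simps linear_rules[OF T.linear_\<epsilon>])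

text \<open>
  For \<open>x = r 1\<close> the defect of primitivity is \<open>- r (1 \<otimes> 1)\<close>; since \<open>\<epsilon>\<close> vanishes on \<open>J\<close>, this lies in \<open>K\<close> only
  if \<open>r = 0\<close>.
\<close>

lemma scalar_prim:
  assumes "sc T r 1 \<in> prim" shows "r = 0"
proof -
  let ?d = "\<Delta> (sc T r 1) - sc T r 1 \<otimes> 1 - 1 \<otimes> sc T r 1"
  have "?d \<in> K" using assms unfolding prim_def by simp
  then have "counit_left T \<epsilon> ?d \<in> J"
    by (rule K_into[OF linear_counit_left subspace_ideal[OF ideal_J], rotated 2])
      (auto simp: counit_left_apply counit_J J_rules TS.subspace_scale[OF subspace_ideal[OF ideal_J]])
  then have "sc T (- r) 1 \<in> J"
    by (simp add: counit_Delta counit_left_apply linear_rules[OF linear_counit_left]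
        linear_rules[OF T.linear_\<epsilon>] epsilon_simps)
  then show ?thesis
    using counit_J[of "sc T (- r) 1"] by (simp only: linear_rules[OF T.linear_\<epsilon>] epsilon_simps) simp
qed

abbreviation I where "I \<equiv> enveloping_ideal T \<iota> \<Delta> b"

lemma ideal_I: "two_sided_ideal I"
  unfolding enveloping_ideal_def by (rule two_sided_ideal_hull)

lemma E_I: "x \<in> E \<Longrightarrow> x - \<iota> (b x) \<in> I"
  unfolding enveloping_ideal_def by (rule hull_inc) blast

lemma J_subset_I: "J \<subseteq> I"
  unfolding J_def
  by (rule hull_minimal) (auto simp: gen_def beta_def ideal_I intro: E_I rel_E)

lemma iota_diff_I:
  assumes "\<iota> v - \<iota> w \<in> I" shows "v = w"
  using ideal_coset_eq[OF ideal_I assms] i_U_inj unfolding inj_def i_U_def by blast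

text \<open>
  The counit excludes a scalar part, and \<open>V \<inter> J = 0\<close> because \<open>J \<subseteq> I\<close> and \<open>V\<close> meets \<open>I\<close> trivially.
\<close>

lemma iota_J:
  assumes "\<iota> v + l \<in> J" "l \<in> fil (Suc 0)" shows "v = 0"
proof -
  obtain r where l: "l = sc T r 1" using fil_one[OF assms(2)] .
  have "\<epsilon> (\<iota> v) = 0" by (rule primitive_counit) (rule primitive)
  then have "r = 0"
    using counit_J[OF assms(1)] by (simp add: l linear_rules[OF T.linear_\<epsilon>] epsilon_simps)
  then have "\<iota> v - \<iota> 0 \<in> I"
    using assms(1) J_subset_I by (auto simp: l iota_rules)
  then show ?thesis by (rule iota_diff_I)
qed

text \<open>
  The hypothesis on \<open>J\<close> in degree \<open>n\<close>, and \<open>iota_J\<close> in degree one, say that linear maps \<open>f\<close> and \<open>g\<close> on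
  \<open>T\<close> exist which vanish on \<open>J\<close> and on lower degrees, such that \<open>f\<close> is the identity on \<open>V\<close> and \<open>g\<close> the
  identity on \<open>T\<^sup>n\<close> modulo \<open>N n\<close>.  The map \<open>f \<otimes> g\<close> followed by multiplication then vanishes on \<open>K\<close>, and
  of \<open>\<Delta> (w + l)\<close> it sees only the component of \<open>\<Delta> w\<close> in \<open>V \<otimes> T\<^sup>n\<close>, which multiplies to \<open>(n + 1)\<^sub>q w\<close>.
\<close>

lemma leading_term_prim:
  assumes n: "n \<ge> 1"
    and lead: "\<And>w l. w \<in> deg n \<Longrightarrow> l \<in> fil n \<Longrightarrow> w + l \<in> J \<Longrightarrow> w \<in> N n"
    and w: "w \<in> deg (Suc n)" and l: "l \<in> fil (Suc n)" and wl: "w + l \<in> prim"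
  shows "w \<in> N (Suc n)"
proof -
  note subspace_J = subspace_ideal[OF ideal_J]
  note sum = span_Un_subspaces[OF subspace_J subspace_fil]
  obtain f where f: "Vector_Spaces.linear (sc T) (sc T) f" "\<forall>x\<in>TS.span (J \<union> fil 1). f x = 0"
      "\<forall>x\<in>range \<iota>. f x - x \<in> range \<iota> \<inter> TS.span (J \<union> fil 1)"
    using projection_along_subspace[OF space_T TS.subspace_span subspace_range[OF linear_iota]] by blast
  obtain g where g: "Vector_Spaces.linear (sc T) (sc T) g" "\<forall>x\<in>TS.span (J \<union> fil n). g x = 0"
      "\<forall>x\<in>deg n. g x - x \<in> deg n \<inter> TS.span (J \<union> fil n)"
    using projection_along_subspace[OF space_T TS.subspace_span subspace_deg] by blast
  have f_J: "f x = 0" and g_J: "g x = 0" if "x \<in> J" for x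
    using f(2) g(2) TS.span_base that by blast+
  have f_fil: "f x = 0" if "x \<in> fil 1" for x
    using f(2) TS.span_base that by blast
  have g_fil: "g x = 0" if "x \<in> deg i" "i < n" for x i
    using g(2) TS.span_base deg_fil[OF that] by blast
  have f_iota: "f (\<iota> v) = \<iota> v" for v
  proof -
    have "f (\<iota> v) - \<iota> v \<in> range \<iota> \<inter> TS.span (J \<union> fil 1)" using f(3) by blast
    then obtain u j l where u: "f (\<iota> v) - \<iota> v = \<iota> u" "j \<in> J" "l \<in> fil 1" "\<iota> u = j + l"
      using sum by (metis IntE imageE)
    then have "\<iota> u + (- l) \<in> J" by simp
    then have "u = 0" using u(3) TS.subspace_neg[OF subspace_fil] by (intro iota_J[of u "- l"]) auto
    then show ?thesis using u(1) by (simp add: iota_rules)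
  qed
  have g_deg: "g x - x \<in> N n" if "x \<in> deg n" for x
  proof -
    have "g x - x \<in> deg n \<inter> TS.span (J \<union> fil n)" using g(3) that by blast
    then obtain j l where u: "g x - x \<in> deg n" "j \<in> J" "l \<in> fil n" "g x - x = j + l"
      using sum by blast
    then have "(g x - x) + (- l) \<in> J" by simp
    then show ?thesis using u by (intro lead[of _ "- l"] TS.subspace_neg[OF subspace_fil])
  qed
  let ?D = "\<lambda>Z. mulT (tmap f g Z)"
  have D_linear: "Vector_Spaces.linear (sc2 T) (sc T) ?D"
    by (rule linear_comp[OF tmap(1)[OF f(1) g(1)] mulT_linear])
  have D: "?D (x \<otimes> y) = f x * g y" for x y
    by (simp add: tmap(2)[OF f(1) g(1)] mulT)
  note D_rules = linear_rules[OF D_linear]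
  have one: "f 1 = 0" "g 1 = 0"
    using f_fil[OF deg_fil[OF one_deg]] g_fil[OF one_deg] n by simp_all
  \<comment> \<open>The right factor of a summand of \<open>B\<close> has degree less than \<open>n\<close>.\<close>
  have D_high: "?D B = 0" if "B \<in> high m" "m \<le> Suc n" for B m
  proof -
    have "?D B \<in> {0}"
      by (rule high_into[OF D_linear TS.subspace_single_0 _ that(1)]) (use g_fil that(2) in \<open>auto simp: D\<close>)
    then show ?thesis by simp
  qed
  have D_low: "?D (\<Delta> x) = 0" if "x \<in> fil (Suc n)" for x
  proof -
    have deg: "?D (\<Delta> x) \<in> {0}" if "x \<in> deg m" "m < Suc n" for x m
    proof (rule linear_span_into[OF linear_comp[OF T.linear_\<Delta> D_linear] TS.subspace_single_0 _
          that(1)[unfolded degree_part_def]])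
      fix w assume "w \<in> {prod_list (map \<iota> vs) |vs. length vs = m}"
      then obtain vs where vs: "w = prod_list (map \<iota> vs)" "length vs = m" by blast
      obtain A B where AB: "\<Delta> w = 1 \<otimes> w + A + B" "A \<in> first m" "B \<in> high m"
        using Delta_word[of vs] vs by blast
      have "?D A \<in> {0}"
        by (rule first_into[OF D_linear TS.subspace_single_0 _ AB(2)]) (use g_fil that(2) in \<open>auto simp: D\<close>)
      then show "?D (\<Delta> w) \<in> {0}"
        using D_high[OF AB(3)] that(2) by (simp add: AB(1) D_rules D one)
    qed
    have "?D (\<Delta> x) \<in> {0}"
      by (rule linear_span_into[OF linear_comp[OF T.linear_\<Delta> D_linear] TS.subspace_single_0 _
            that[unfolded fil_def]]) (use deg in blast)
    then show ?thesis by simp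
  qed
  let ?q = "\<Sum>i<Suc n. q ^ i"
  have lin: "Vector_Spaces.linear (sc T) (sc T) (\<lambda>x. ?D (\<Delta> x) - sc T ?q x)"
    by (rule linear_plus_minus(2)[OF linear_comp[OF T.linear_\<Delta> D_linear]
          linear_plus_minus(3)[OF linear_identity(2)[OF space_T] linear_comp[OF T.linear_\<Delta> D_linear]]])
  have "?D (\<Delta> w) - sc T ?q w \<in> N (Suc n)"
  proof (rule linear_span_into[OF lin subspace_N _ w[unfolded degree_part_def]])
    fix w assume "w \<in> {prod_list (map \<iota> vs) |vs. length vs = Suc n}"
    then obtain vs where vs: "w = prod_list (map \<iota> vs)" "length vs = Suc n" by blast
    obtain A B where AB: "\<Delta> w = 1 \<otimes> w + A + B" "A \<in> first (Suc n)" "B \<in> high (Suc n)"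
        "mulT A - sc T ?q w \<in> N (Suc n)"
      using Delta_word[of vs] vs by auto
    have "?D A - mulT A \<in> N (Suc n)"
    proof (rule first_into[OF linear_plus_minus(2)[OF D_linear mulT_linear] subspace_N _ AB(2)])
      fix v t j assume t: "t \<in> deg j" "Suc n = Suc j"
      have "?D (\<iota> v \<otimes> t) - mulT (\<iota> v \<otimes> t) = \<iota> v * (g t - t)"
        by (simp add: D mulT f_iota right_diff_distrib)
      then show "?D (\<iota> v \<otimes> t) - mulT (\<iota> v \<otimes> t) \<in> N (Suc n)"
        using iota_mult_N[OF g_deg] t by simp
    qed
    from TS.subspace_add[OF subspace_N this AB(4)]
    show "?D (\<Delta> w) - sc T ?q w \<in> N (Suc n)"
      using D_high[OF AB(3)] by (simp add: AB(1) D_rules D one)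
  qed
  moreover have "?D (\<Delta> w) = 0"
  proof -
    have "?D (\<Delta> (w + l) - (w + l) \<otimes> 1 - 1 \<otimes> (w + l)) \<in> {0}"
      by (rule K_into[OF D_linear TS.subspace_single_0 _ _ wl[unfolded prim_def mem_Collect_eq]])
        (simp_all add: D f_J g_J)
    then have "?D (\<Delta> (w + l)) = 0" by (simp add: D_rules(4) D one)
    then show ?thesis using D_low[OF l] by (simp add: Delta_rules D_rules(1))
  qed
  ultimately have "sc T (- 1) (sc T (inverse ?q) (0 - sc T ?q w)) \<in> N (Suc n)"
    by (intro TS.subspace_scale[OF subspace_N]) simp
  moreover have "?q \<noteq> 0"
  proof -
    have "2 \<le> Suc n" using n by simp
    then show ?thesis using regular unfolding regular_mark_def by blast
  qed
  ultimately show ?thesis by simp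
qed

text \<open>
  The case of degree one is \<open>iota_J\<close>, as \<open>N 1 = 0\<close>; higher degrees follow by induction because the
  elements of \<open>J\<close> are primitive modulo \<open>J\<close>.
\<close>

lemma leading_term_J:
  assumes "w \<in> deg (Suc n)" "l \<in> fil (Suc n)" "w + l \<in> J"
  shows "w \<in> N (Suc n)"
  using assms
proof (induction n arbitrary: w l)
  case 0
  obtain v where "w = \<iota> v" using deg_one[OF 0(1)] .
  moreover from this 0 have "v = 0" by (intro iota_J[of v l]) simp_all
  ultimately have "w = 0" by (simp add: iota_rules)
  then show ?case by (simp add: TS.subspace_0[OF subspace_N])
next
  case (Suc n)
  show ?case
    by (rule leading_term_prim[OF _ Suc.IH Suc.prems(1,2) J_prim[OF Suc.prems(3)]]) simp_all
qed

text \<open>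
  The leading term lies in the ideal of the relations and can therefore be replaced, modulo \<open>J\<close>, by a
  term of smaller degree.
\<close>

lemma prim_V:
  assumes "x \<in> fil (Suc n)" "x \<in> prim"
  shows "\<exists>v. x - \<iota> v \<in> J"
  using assms
proof (induction n arbitrary: x)
  case 0
  obtain r where "x = sc T r 1" using fil_one[OF 0(1)] .
  then have "x - \<iota> 0 = 0" using scalar_prim 0(2) by (auto simp: iota_rules)
  then show ?case using J_rules(1) by metis
next
  case (Suc n)
  obtain w l where wl: "w \<in> deg (Suc n)" "l \<in> fil (Suc n)" "x = w + l"
    using fil_Suc[OF Suc.prems(1)] .
  show ?case
  \<comment> \<open>In degree one subtracting the leading term, which is primitive, leaves a scalar.\<close>
  proof (cases n)
    case 0
    obtain v where v: "w = \<iota> v" using deg_one wl(1) 0 by blast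
    have "l = x - \<iota> v" by (simp add: wl v)
    then have "l \<in> prim"
      using Suc.prems(2) primitive_prim[OF primitive] TS.subspace_diff[OF subspace_prim] by blast
    then obtain u where "l - \<iota> u \<in> J" using Suc.IH wl(2) by blast
    moreover have "l - \<iota> u = x - \<iota> (v + u)" by (simp add: wl v iota_rules)
    ultimately show ?thesis by metis
  next
    case (Suc m)
    have "w \<in> N (Suc n)"
    proof (rule leading_term_prim[OF _ _ wl(1,2)])
      show "w' \<in> N n" if "w' \<in> deg n" "l' \<in> fil n" "w' + l' \<in> J" for w' l'
        using leading_term_J[of w' m l'] that Suc by simp
    qed (use Suc wl Suc.prems(2) in simp_all)
    then obtain l' where l': "l' \<in> deg n" "w - l' \<in> J" using N_lower[of w "Suc n"] by auto
    have eq: "x - (w - l') = l' + l" by (simp add: wl)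
    have "l' + l \<in> fil (Suc n)"
      using deg_fil[OF l'(1)] wl(2) TS.subspace_add[OF subspace_fil] by blast
    moreover have "l' + l \<in> prim"
      using TS.subspace_diff[OF subspace_prim Suc.prems(2) J_prim[OF l'(2)]] eq by simp
    ultimately obtain v where "l' + l - \<iota> v \<in> J" using Suc.IH by blast
    from J_rules(2)[OF l'(2) this] show ?thesis by (auto simp: wl algebra_simps)
  qed
qed

text \<open>
  By \<open>prim_V\<close> the primitive element \<open>x\<close> is congruent to some \<open>v \<in> V\<close> modulo \<open>J\<close>.  As \<open>x\<close> is also congruent to
  \<open>b x\<close> modulo \<open>I\<close>, the injectivity of \<open>i_U\<close> gives \<open>v = b x\<close>.
\<close>

lemma E_J:
  assumes "x \<in> E" shows "x - \<iota> (b x) \<in> J"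
proof -
  have E0: "b 0 = 0" using b_linear_on_E(2)[of 0 0] TS.subspace_0[OF subspace_E] by simp
  have "x \<in> E \<and> x - \<iota> (b x) \<in> J"
    using assms unfolding E_space_def
  proof (induction rule: TS.span_induct_alt)
    case base
    show ?case using E0 TS.span_zero by (simp add: iota_rules J_rules)
  next
    case (step r x y)
    then obtain n where n: "n \<ge> 2" "x \<in> E_part T \<iota> \<Delta> n" by blast
    have xE: "x \<in> E" and yE: "y \<in> E" using step unfolding E_space_def by (auto intro: TS.span_base)
    have "x \<in> deg n" "x \<in> prim"
      using n E_part_primitive_iff primitive_prim by blast+
    then obtain v where v: "x - \<iota> v \<in> J" using prim_V[of x n] deg_fil by blast
    have "\<iota> (b x) - \<iota> v \<in> I"
      using two_sided_ideal_diff[OF ideal_I subsetD[OF J_subset_I v] E_I[OF xE]] by simp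
    then have "v = b x" by (metis iota_diff_I)
    moreover have eq: "sc T r x + y - \<iota> (b (sc T r x + y)) = sc T r (x - \<iota> (b x)) + (y - \<iota> (b y))"
      using xE yE b_linear_on_E TS.subspace_scale[OF subspace_E]
      by (simp add: iota_rules TS.scale_right_diff_distrib)
    moreover have mem: "sc T r (x - \<iota> v) + (y - \<iota> (b y)) \<in> J"
      using step v by (intro J_rules(2) TS.subspace_scale[OF subspace_ideal[OF ideal_J]]) simp_all
    moreover have "sc T r x + y \<in> E"
      using xE yE by (intro TS.subspace_add[OF subspace_E] TS.subspace_scale[OF subspace_E])
    ultimately show ?case
      unfolding E_space_def by (simp only:)
  qed
  then show ?thesis by blast
qed

lemma enveloping_ideal_eq: "I = J"
proof
  show "I \<subseteq> J"
    unfolding enveloping_ideal_def by (rule hull_minimal) (use E_J ideal_J in blast)+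
qed (rule J_subset_I)

section \<open>Vanishing of the bracket for marks different from one\<close>

lemma beta_c: "beta (c z) = - beta z"
proof -
  have "c (c z) - sc2 V q (c z) = - (c z - sc2 V q z)"
    using hecke_eq[of z] by (simp add: linear_rules[OF V.linear_braiding])
  then have "rel (c z) = sc T (- 1) (rel z)"
    unfolding rel_def by (simp add: linear_rules[OF incl2(1)])
  then show ?thesis
    unfolding beta_def using b_linear_on_E(2)[OF rel_E, of "- 1" z] by simp
qed

lemma c12_square:
  "c1 (c1 Y) = sc3 V (q - 1) (c1 Y) + sc3 V q Y" "c2 (c2 Y) = sc3 V (q - 1) (c2 Y) + sc3 V q Y"
proof -
  note id = linear_identity(2)[OF V.cube_spaces(3)]
  show "c1 (c1 Y) = sc3 V (q - 1) (c1 Y) + sc3 V q Y"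
    by (rule tensor_linear_eq[OF V.tensor_21 linear_comp[OF c12_linear(1) c12_linear(1)]
        linear_plus_minus(1)[OF linear_plus_minus(3)[OF c12_linear(1) c12_linear(1)]
            linear_plus_minus(3)[OF id id]]])
      (simp add: c12_apply c_square linear_rules[OF tens21_linear(1)])
  show "c2 (c2 Y) = sc3 V (q - 1) (c2 Y) + sc3 V q Y"
    by (rule tensor_linear_eq[OF V.tensor_12 linear_comp[OF c12_linear(2) c12_linear(2)]
        linear_plus_minus(1)[OF linear_plus_minus(3)[OF c12_linear(2) c12_linear(2)]
            linear_plus_minus(3)[OF id id]]])
      (simp add: c12_apply c_square linear_rules[OF tens12_linear(2)])
qed

lemma betaV_c1: "betaV (c1 Y) = - betaV Y"
proof -
  have "betaV (c1 Y) = sc2 V (- 1) (betaV Y)"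
    by (rule tensor_linear_eq[OF V.tensor_21 linear_comp[OF c12_linear(1) betaV(1)]
          linear_plus_minus(3)[OF betaV(1) betaV(1)]])
      (simp add: betaV c12_apply beta_c bilinear_map_rules[OF tensor_product_bilinear[OF V.tensor_11]])
  then show ?thesis by simp
qed

lemma Vbeta_c2: "Vbeta (c2 Y) = - Vbeta Y"
proof -
  have "Vbeta (c2 Y) = sc2 V (- 1) (Vbeta Y)"
    by (rule tensor_linear_eq[OF V.tensor_12 linear_comp[OF c12_linear(2) Vbeta(1)]
          linear_plus_minus(3)[OF Vbeta(1) Vbeta(1)]])
      (simp add: Vbeta c12_apply beta_c bilinear_map_rules[OF tensor_product_bilinear[OF V.tensor_11]])
  then show ?thesis by simp
qed

text \<open>
  Write \<open>A = \<beta> \<otimes> V\<close> and \<open>B = V \<otimes> \<beta>\<close>, so that \<open>c A = B c\<^sub>1 c\<^sub>2\<close>, \<open>c B = A c\<^sub>2 c\<^sub>1\<close>, \<open>A c\<^sub>1 = - A\<close> and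
  \<open>B c\<^sub>2 = - B\<close>.  Evaluating \<open>c\<^sup>2 A\<close> in two ways and cancelling \<open>q - 1\<close> gives \<open>c A + c B = q A (c\<^sub>2 + 1)\<close>, and
  symmetrically \<open>c A + c B = q B (c\<^sub>1 + 1)\<close>.  Comparing the two after composing with \<open>c\<^sub>1\<close> and \<open>c\<^sub>2\<close> gives
  \<open>c A = - A\<close> and \<open>c B = - B\<close>, and then \<open>(1 + q + q\<^sup>2) (A + B) = 0\<close>.
\<close>

lemma betaV_eq_minus_Vbeta:
  assumes q1: "q \<noteq> 1"
  shows "betaV Y = - Vbeta Y"
proof -
  have q0: "q \<noteq> 0" using hecke unfolding hecke_type_def by blast
  note scale = V2S.scale_right_distrib V2S.scale_right_diff_distrib V2S.scale_left_distrib
    V2S.scale_left_diff_distrib algebra_simps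
  note lin = linear_rules[OF betaV(1)] linear_rules[OF Vbeta(1)] linear_rules[OF c12_linear(1)]
    linear_rules[OF c12_linear(2)]
  have A: "c (betaV Y) + c (Vbeta Y) = sc2 V q (betaV (c2 Y) + betaV Y)" for Y
  proof -
    have "c (c (betaV Y)) = betaV (c2 (c1 (c1 (c2 Y))))" by (simp only: c_betaV c_Vbeta)
    also have "\<dots> = - sc2 V (q - 1) (c (Vbeta Y)) + sc2 V q (sc2 V (q - 1) (betaV (c2 Y)) + sc2 V q (betaV Y))"
      by (simp add: c12_square lin braid[symmetric] betaV_c1 c_Vbeta)
    finally have "sc2 V (q - 1) (c (betaV Y) + c (Vbeta Y) - sc2 V q (betaV (c2 Y) + betaV Y)) = 0"
      unfolding c_square by (simp add: scale)
    then show ?thesis using q1 by simp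
  qed
  have B: "c (betaV Y) + c (Vbeta Y) = sc2 V q (Vbeta (c1 Y) + Vbeta Y)" for Y
  proof -
    have "c (c (Vbeta Y)) = Vbeta (c1 (c2 (c2 (c1 Y))))" by (simp only: c_betaV c_Vbeta)
    also have "\<dots> = - sc2 V (q - 1) (c (betaV Y)) + sc2 V q (sc2 V (q - 1) (Vbeta (c1 Y)) + sc2 V q (Vbeta Y))"
      by (simp add: c12_square lin braid Vbeta_c2 c_betaV)
    finally have "sc2 V (q - 1) (c (betaV Y) + c (Vbeta Y) - sc2 V q (Vbeta (c1 Y) + Vbeta Y)) = 0"
      unfolding c_square by (simp add: scale)
    then show ?thesis using q1 by simp
  qed
  have AB: "betaV (c2 Y) + betaV Y = Vbeta (c1 Y) + Vbeta Y" for Y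
    using A[of Y] B[of Y] q0 by (metis V2S.scale_cancel_left)
  have cA: "c (betaV Y) = - betaV Y" for Y
  proof -
    have "betaV Y + c (betaV Y) = 0"
      using AB[of "c1 Y"] B[of Y] by (simp add: c12_square lin betaV_c1 c_Vbeta scale)
    then show ?thesis by (simp add: add_eq_0_iff)
  qed
  have cB: "c (Vbeta Y) = - Vbeta Y" for Y
  proof -
    have "Vbeta (c1 (c2 Y)) = Vbeta Y + sc2 V q (betaV (c2 Y) + betaV Y)"
      using AB[of "c2 Y"] by (simp add: c12_square lin Vbeta_c2 scale)
    then have "(Vbeta Y + c (Vbeta Y)) + sc2 V q (betaV (c2 Y) + betaV Y) = sc2 V q (betaV (c2 Y) + betaV Y)"
      using A[of Y] by (simp add: c_betaV ac_simps)
    then show ?thesis by (simp only: add_cancel_left_left add_eq_0_iff)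
  qed
  have 1: "sc2 V q (Vbeta (c1 Y) + Vbeta Y) = - betaV Y - Vbeta Y" for Y
    using B[of Y] by (simp add: cA cB)
  have 2: "Vbeta (c1 Y) = sc2 V (1 + q) (betaV Y) + sc2 V q (Vbeta Y)"
  proof -
    have "Vbeta (c1 (c1 Y)) + Vbeta (c1 Y) = sc2 V q (Vbeta (c1 Y) + Vbeta Y)"
      by (simp add: c12_square lin scale)
    then have "sc2 V q (- betaV Y - Vbeta Y) = betaV Y - Vbeta (c1 Y)"
      using 1[of "c1 Y"] unfolding 1[of Y] by (simp add: betaV_c1)
    then show ?thesis by (simp add: scale)
  qed
  have "sc2 V (1 + q + q * q) (betaV Y + Vbeta Y) = 0"
    using 1[of Y] unfolding 2 by (simp add: scale)
  moreover have "1 + q + q * q \<noteq> 0"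
  proof -
    have "(\<Sum>i<3. q ^ i) \<noteq> 0" using regular unfolding regular_mark_def by simp
    then show ?thesis by (simp add: eval_nat_numeral algebra_simps)
  qed
  ultimately show ?thesis by (simp add: eq_neg_iff_add_eq_0)
qed

text \<open>
  If \<open>\<beta> (x \<otimes> y) \<noteq> 0\<close>, choose a functional \<open>f\<close> with value 1 on it.  Applying \<open>f \<otimes> V\<close> to
  \<open>\<beta> (x \<otimes> y) \<otimes> y = - x \<otimes> \<beta> (y \<otimes> y)\<close> shows that \<open>\<beta> (y \<otimes> y)\<close> is a nonzero multiple of \<open>y\<close>, which contradicts
  \<open>\<beta> (y \<otimes> y) \<otimes> y = - y \<otimes> \<beta> (y \<otimes> y)\<close> because \<open>2 \<noteq> 0\<close>.
\<close>

lemma beta_zero: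
  assumes "q \<noteq> 1" "CHAR('k) \<noteq> 2"
  shows "beta z = 0"
proof -
  note V_rules = bilinear_map_rules[OF tensor_product_bilinear[OF V.tensor_11]]
  have two: "(2 :: 'k) \<noteq> 0"
  proof
    assume "(2 :: 'k) = 0"
    then have "CHAR('k) dvd 2"
      using of_nat_eq_0_iff_char_dvd[where ?'a = 'k, of 2] by simp
    then have "CHAR('k) \<le> 2" "CHAR('k) \<noteq> 0"
      by (simp add: dvd_imp_le, metis dvd_0_left zero_neq_numeral)
    then have "CHAR('k) = 1" using assms(2) by linarith
    then show False by simp
  qed
  have swap: "tens V (beta (tens V x y)) z = - tens V x (beta (tens V y z))" for x y z
    using betaV_eq_minus_Vbeta[OF assms(1), of "tens21 V (tens V x y) z"]
    by (simp add: betaV V.tens_assoc Vbeta) (simp add: betaV Vbeta V.tens_assoc[symmetric])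
  have "beta (tens V x y) = 0" for x y
  proof (rule ccontr)
    assume w: "beta (tens V x y) \<noteq> 0"
    obtain f where f: "Vector_Spaces.linear (sc V) (*) f" "f (beta (tens V x y)) = 1"
      using linear_functional_nonzero[OF space_V w] by blast
    have bil: "bilinear_map (sc V) (sc V) (sc V) (\<lambda>u v. sc V (f u) v)"
      unfolding bilinear_map_def Vector_Spaces.linear_iff using space_V
      by (simp add: linear_rules[OF f(1)] VS.scale_left_distrib VS.scale_right_distrib mult.commute)
    note h = tensor_lift[OF V.tensor_11 space_V bil]
    have "y \<noteq> 0" using w by (auto simp: V_rules linear_rules[OF linear_beta])
    have y: "y = - sc V (f x) (beta (tens V y y))"
      using arg_cong[OF swap[of x y y], of "tensor_lift (sc2 V) (tens V) (sc V) (\<lambda>u v. sc V (f u) v)"] f(2)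
      by (simp add: h linear_rules[OF h(1)])
    then have "f x \<noteq> 0" using \<open>y \<noteq> 0\<close> by auto
    define r where "r = - inverse (f x)"
    have "sc V r y = beta (tens V y y)"
      using y \<open>f x \<noteq> 0\<close> unfolding r_def by (metis VS.scale_minus_left VS.scale_minus_right VS.scale_one VS.scale_scale left_inverse minus_minus)
    then have "sc2 V r (tens V y y) = - sc2 V r (tens V y y)"
      using swap[of y y y] by (simp add: V_rules flip: \<open>sc V r y = _\<close>)
    then have "sc2 V (2 * r) (tens V y y) = 0"
      by (metis add.right_inverse mult_2 V2S.scale_left_distrib)
    then have "tens V y y = 0" using two \<open>f x \<noteq> 0\<close> by (simp add: r_def)
    with \<open>y \<noteq> 0\<close> nonzero_tensor_eq_zero[OF V.tensor_11] show False by blast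
  qed
  then show ?thesis
    by (induction z rule: tensor_induct[OF V.tensor_11]) (simp_all add: linear_rules[OF linear_beta])
qed

lemma hecke_bracket_eq: "hecke_bracket V c (sc T) \<iota> b q z = beta z"
  by (simp add: hecke_bracket_def beta_def rel_def)

end

section \<open>The enveloping algebra of a braided Lie algebra of Hecke type\<close>

theorem theorem8p4:
  fixes V :: "('k::field, 'v::ab_group_add, 'v2::ab_group_add, 'v3::ab_group_add) cube_data"
    and c :: "'v2 \<Rightarrow> 'v2"
    and T :: "('k, 't::ring_1, 't2::ab_group_add, 't3::ab_group_add, 't4::ab_group_add) fourth_data"
    and \<iota> :: "'v \<Rightarrow> 't" and \<Delta> :: "'t \<Rightarrow> 't2" and \<epsilon> :: "'t \<Rightarrow> 'k" and cT :: "'t2 \<Rightarrow> 't2"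
    and b :: "'t \<Rightarrow> 'v" and q :: 'k
  assumes "braided_lie_algebra V c T \<iota> \<Delta> \<epsilon> cT b"
    and "hecke_type V c q"
    and "regular_mark q"
  shows "enveloping_algebra T \<iota> \<Delta> b =
      quotient_algebra (sc T)
        (two_sided_ideal hull
          {tens2_incl V (sc T) \<iota> (c z) - sc T q (tens2_incl V (sc T) \<iota> z)
             - \<iota> (hecke_bracket V c (sc T) \<iota> b q z) | z. True}) \<and>
    (q \<noteq> 1 \<and> CHAR('k) \<noteq> 2 \<longrightarrow> (\<forall>z. hecke_bracket V c (sc T) \<iota> b q z = 0))"
proof -
  interpret braided_lie_algebra V c T \<iota> \<Delta> \<epsilon> cT b by fact
  interpret hecke_lie_algebra V c T \<iota> \<Delta> \<epsilon> cT b q by unfold_locales fact+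
  have "{tens2_incl V (sc T) \<iota> (c z) - sc T q (tens2_incl V (sc T) \<iota> z)
      - \<iota> (hecke_bracket V c (sc T) \<iota> b q z) | z. True} = range gen"
    by (auto simp: hecke_bracket_eq gen_def rel_def linear_rules[OF incl2(1)])
  then show ?thesis
    using enveloping_ideal_eq beta_zero
    by (simp add: enveloping_algebra_def J_def hecke_bracket_eq)
qed

end
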